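(* Let $n\ge3$, let $x_1<\dots<x_n$ be real numbers, and let $g\sim\mathcal{N}(0,I_{n\times n})$. Then $$\delta(\mathcal{K}^C_{x_1,\dots,x_n})=\mathbb{E}\left[\left|\Pi_{\mathcal{K}^C_{x_1,\dots,x_n}}(g)\right|_2^2\right]\le8\log(en).$$
   Context: $\mathcal{K}^C_{x_1,\dots,x_n}=\left\{u\in\mathbb{R}^n:\ \frac{u_i-u_{i-1}}{x_i-x_{i-1}}\le\frac{u_{i+1}-u_i}{x_{i+1}-x_i},\ i=2,\dots,n-1\right\}$, equivalently the set of vectors $(f(x_1),\dots,f(x_n))^T$ with $f:\mathbb{R}\to\mathbb{R}$ convex. $|\cdot|_2$ is the Euclidean norm and $\Pi_L$ is the Euclidean projection onto a closed convex cone $L$. The statistical dimension of a closed convex cone $L\subset\mathbb{R}^n$ is $\delta(L)=\mathbb{E}\left[|\Pi_L(g)|_2^2\right]$. *)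

theory Defs
  imports "HOL-Probability.Probability"
begin

text \<open>
  \<open>\<real>\<^sup>n\<close> is \<open>real ^ 'n\<close> with a linearly ordered finite index type, where \<open>n = CARD('n)\<close>.
  The \<open>i\<close>-th coordinate of \<open>u\<close>, for \<open>1 \<le> i \<le> n\<close>, is \<open>u $ idx i\<close>.
\<close>

definition idx :: "nat \<Rightarrow> 'n::{finite, linorder}" where
  "idx i = sorted_list_of_set UNIV ! (i - 1)"

definition convex_seq_cone :: "real ^ 'n::{finite, linorder} \<Rightarrow> (real ^ 'n::{finite, linorder}) set" where
  "convex_seq_cone x =
    {u. \<forall>i\<in>{2..CARD('n) - 1}.
      (u $ idx i - u $ idx (i - 1)) / (x $ idx i - x $ idx (i - 1))
        \<le> (u $ idx (i + 1) - u $ idx i) / (x $ idx (i + 1) - x $ idx i)}"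

definition std_gaussian_density :: "real ^ 'n::finite \<Rightarrow> real" where
  "std_gaussian_density z = (\<Prod>i\<in>UNIV. std_normal_density (z $ i))"

definition std_gaussian :: "(real ^ 'n::finite) measure" where
  "std_gaussian = density lborel (\<lambda>z. ennreal (std_gaussian_density z))"

definition statistical_dimension :: "(real ^ 'n::finite) set \<Rightarrow> real" where
  "statistical_dimension L = (LINT z|std_gaussian. (norm (closest_point L z))\<^sup>2)"

end

theory Submission
  imports Defs
begin

text \<open>
  A convex sequence decreases up to some index \<open>j\<close> and increases afterwards, so the squared norm \<open>V\<close> of
  the projection of \<open>g\<close> is at most the maximum over \<open>j\<close> of the sum of the squared norms of two isotonic
  projections, of \<open>j\<close> and of \<open>n - j\<close> independent Gaussians. Everything is reduced to the exponential
  moment \<open>Z n\<close> of \<open>3/8\<close> times the squared norm of the isotonic projection of \<open>n\<close> Gaussians, and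
  \<open>Z n \<le> n + 1\<close>: the expectation of \<open>exp (3/8 * V)\<close> is then at most
  \<open>\<Sum>j\<le>n. Z j * Z (n - j) \<le> (n + 1)^3 \<le> (e n)^3\<close>, and Jensen gives \<open>E V \<le> 8/3 * ln ((e n)^3)\<close>.

  To bound \<open>Z n\<close>, sum the lengths of the level blocks of the isotonic projection, which add up to \<open>n\<close>.
  A block of length \<open>k\<close> with mean \<open>a\<close> has prefix sums at least those of the constant sequence \<open>a\<close>; almost
  surely exactly one cyclic shift of a sequence has this property, hence it has probability \<open>1/k\<close> given
  the mean. Once the block is deleted, its position is the strict minimiser of the random walk formed by
  the remaining values minus \<open>a\<close>, so there is at most one such position. Since
  \<open>E exp (3/8 * k * a^2) = 2\<close>, this gives \<open>n * Z n \<le> 2 * (\<Sum>k=1..n. Z (n - k))\<close>.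
\<close>

section \<open>Isotonic projection and its level blocks\<close>

text \<open>Completing the square shows that this is |x|^2 - |x - u|^2 on the first \<open>n\<close>
  coordinates, so maximising it over a cone is the same as projecting onto that cone.\<close>

definition quad_gain :: "nat \<Rightarrow> (nat \<Rightarrow> real) \<Rightarrow> (nat \<Rightarrow> real) \<Rightarrow> real" where
  "quad_gain n x u = (\<Sum>i<n. 2 * x i * u i - (u i)\<^sup>2)"

text \<open>This supremum is the squared norm of the projection of \<open>(x 0, \<dots>, x (n - 1))\<close> onto the monotone cone.\<close>

definition mono_gain :: "nat \<Rightarrow> (nat \<Rightarrow> real) \<Rightarrow> real" where
  "mono_gain n x = (SUP u\<in>{u. mono_on {..<n} u}. quad_gain n x u)"

lemma quad_gain_le: "quad_gain n x u \<le> (\<Sum>i<n. (x i)\<^sup>2)"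
  unfolding quad_gain_def
proof (rule sum_mono)
  fix i
  show "2 * x i * u i - (u i)\<^sup>2 \<le> (x i)\<^sup>2"
    using zero_le_power2[of "x i - u i"] by (simp add: power2_diff)
qed

lemma bdd_above_quad_gain: "bdd_above (quad_gain n x ` U)"
  by (intro bdd_aboveI2[of _ _ "\<Sum>i<n. (x i)\<^sup>2"] quad_gain_le)

lemma quad_gain_le_mono_gain: "mono_on {..<n} u \<Longrightarrow> quad_gain n x u \<le> mono_gain n x"
  unfolding mono_gain_def by (intro cSUP_upper bdd_above_quad_gain) simp

lemma mono_gain_cong: "(\<And>i. i < n \<Longrightarrow> x i = y i) \<Longrightarrow> mono_gain n x = mono_gain n y"
  unfolding mono_gain_def quad_gain_def by simp

lemma continuous_on_quad_gain [continuous_intros]: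
  "continuous_on A (\<lambda>u. quad_gain n x u)" "continuous_on A (\<lambda>x. quad_gain n x u)"
  unfolding quad_gain_def
  by (auto intro!: continuous_intros continuous_on_subset[OF continuous_on_product_coordinates])

text \<open>Clipping a monotone \<open>u\<close> to the range of the data keeps it monotone and
  moves every entry closer to \<open>x\<close>, so the supremum may be taken over a compact
  set.\<close>

lemma mono_gain_attained:
  obtains p where "mono_on {..<n} p" "mono_gain n x = quad_gain n x p"
proof -
  define R where "R = (\<Sum>i<n. \<bar>x i\<bar>)"
  have R: "\<bar>x i\<bar> \<le> R" if "i < n" for i
    using that unfolding R_def by (intro member_le_sum) auto
  have "R \<ge> 0" unfolding R_def by (intro sum_nonneg) auto
  \<comment> \<open>All coordinates are boxed, including those from \<open>n\<close> on, so that
    compactness of the box in the product topology is Tychonoff's theorem.\<close>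
  define C where "C = (PiE UNIV (\<lambda>_. {-R..R})) \<inter> {u::nat\<Rightarrow>real. \<forall>i<n. \<forall>j<n. i \<le> j \<longrightarrow> u i \<le> u j}"
  have "closed {u::nat\<Rightarrow>real. u i \<le> u j}" for i j
    by (intro closed_Collect_le continuous_on_product_coordinates)
  then have "closed {u::nat\<Rightarrow>real. \<forall>i<n. \<forall>j<n. i \<le> j \<longrightarrow> u i \<le> u j}"
    by (intro closed_Collect_all closed_Collect_imp) auto
  moreover have "compact (PiE UNIV (\<lambda>_::nat. {-R..R}))"
  proof -
    have "compactin (product_topology (\<lambda>_::nat. euclidean) UNIV) (PiE UNIV (\<lambda>_::nat. {-R..R}))"
      unfolding compactin_PiE by simp
    then show ?thesis by (simp add: euclidean_product_topology)
  qed
  ultimately have "compact C" unfolding C_def by (intro compact_Int_closed)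
  moreover have "(\<lambda>_. 0) \<in> C" using \<open>R \<ge> 0\<close> by (auto simp: C_def)
  ultimately obtain p where p: "p \<in> C" "\<And>u. u \<in> C \<Longrightarrow> quad_gain n x u \<le> quad_gain n x p"
    using continuous_attains_sup[of C "quad_gain n x"] continuous_on_quad_gain by blast
  have le: "quad_gain n x u \<le> quad_gain n x p" if u: "mono_on {..<n} u" for u
  proof -
    define v where "v i = max (-R) (min R (u i))" for i
    have "v \<in> C"
      unfolding C_def v_def Int_iff mem_Collect_eq
    proof (intro conjI allI impI)
      show "(\<lambda>i. max (- R) (min R (u i))) \<in> UNIV \<rightarrow>\<^sub>E {- R..R}" using \<open>R \<ge> 0\<close> by auto
      fix i j assume "i < n" "j < n" "i \<le> j"
      then show "max (- R) (min R (u i)) \<le> max (- R) (min R (u j))"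
        by (intro max.mono min.mono mono_onD[OF u]) auto
    qed
    have "quad_gain n x u \<le> quad_gain n x v"
      unfolding quad_gain_def
    proof (rule sum_mono)
      fix i assume "i \<in> {..<n}"
      then have "\<bar>x i\<bar> \<le> R" using R by auto
      then have "\<bar>x i - v i\<bar> \<le> \<bar>x i - u i\<bar>" unfolding v_def by auto
      then have "(x i - v i)\<^sup>2 \<le> (x i - u i)\<^sup>2" by (simp add: abs_le_square_iff)
      then show "2 * x i * u i - (u i)\<^sup>2 \<le> 2 * x i * v i - (v i)\<^sup>2"
        by (simp add: power2_diff)
    qed
    also have "\<dots> \<le> quad_gain n x p" using p(2) \<open>v \<in> C\<close> by auto
    finally show ?thesis .
  qed
  have "mono_on {..<n} p" using p(1) by (auto simp: C_def mono_on_def)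
  moreover have "mono_gain n x \<le> quad_gain n x p"
    unfolding mono_gain_def by (rule cSUP_least) (auto intro: le exI[of _ "\<lambda>_. 0"] mono_onI)
  ultimately show thesis
    using that quad_gain_le_mono_gain[of n p x] by (meson order_antisym)
qed

text \<open>A supremum of continuous functions is lower semicontinuous: its strict superlevel sets
  are unions, here uncountable, of open sets.\<close>

lemma borel_measurable_mono_gain: "mono_gain n \<in> borel_measurable borel"
proof (rule borel_measurableI_greater)
  fix c
  have "{x \<in> space borel. c < mono_gain n x} = (\<Union>u\<in>{u. mono_on {..<n} u}. {x. c < quad_gain n x u})"
    (is "?L = ?R")
  proof safe
    fix x assume "c < mono_gain n x"
    then show "x \<in> ?R" using mono_gain_attained[of n x] by (metis (mono_tags) UN_iff mem_Collect_eq)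
  next
    fix x u assume "mono_on {..<n} u" "c < quad_gain n x u"
    then show "c < mono_gain n x" using quad_gain_le_mono_gain[of n u x] by linarith
  qed simp
  moreover have "open \<dots>"
    by (intro open_UN ballI open_Collect_less continuous_intros)
  ultimately show "?L \<in> sets borel" by simp
qed

text \<open>First-order condition at a maximiser: the sum is half the derivative of
  \<open>quad_gain\<close> at \<open>p\<close> in a direction \<open>v\<close> along which small
  steps stay monotone.\<close>

lemma optimal_variation:
  fixes p v :: "nat \<Rightarrow> real"
  assumes opt: "\<And>u. mono_on {..<n} u \<Longrightarrow> quad_gain n x u \<le> quad_gain n x p"
    and "e0 > 0" and v: "\<And>e. 0 < e \<Longrightarrow> e < e0 \<Longrightarrow> mono_on {..<n} (\<lambda>i. p i + e * v i)"
  shows "(\<Sum>i<n. (x i - p i) * v i) \<le> 0"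
proof (rule ccontr)
  define A where "A = (\<Sum>i<n. (x i - p i) * v i)"
  define B where "B = (\<Sum>i<n. (v i)\<^sup>2)"
  assume "\<not> (\<Sum>i<n. (x i - p i) * v i) \<le> 0"
  then have "A > 0" by (simp add: A_def)
  have "B \<ge> 0" unfolding B_def by (intro sum_nonneg) auto
  \<comment> \<open>This choice gives \<open>e * B\<close> at most \<open>A\<close>, whereas
    optimality forces it to be at least \<open>2 * A\<close>.\<close>
  define e where "e = min (e0 / 2) (A / (B + 1))"
  have e: "0 < e" "e < e0" using \<open>A > 0\<close> \<open>B \<ge> 0\<close> \<open>e0 > 0\<close> by (auto simp: e_def)
  have "quad_gain n x (\<lambda>i. p i + e * v i) = quad_gain n x p + (2 * e * A - e\<^sup>2 * B)"
    unfolding quad_gain_def A_def B_def sum_distrib_left sum.distrib[symmetric] sum_subtractf[symmetric]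
    by (intro sum.cong) (auto simp: power2_eq_square algebra_simps)
  with opt[OF v[OF e]] have "2 * e * A \<le> e\<^sup>2 * B" by simp
  then have "2 * A \<le> e * B" using e by (simp add: power2_eq_square)
  moreover have "e * B \<le> A / (B + 1) * B" unfolding e_def using \<open>B \<ge> 0\<close> by (intro mult_right_mono) auto
  moreover have "A / (B + 1) * B \<le> A" using \<open>B \<ge> 0\<close> \<open>A > 0\<close> by (simp add: field_simps)
  ultimately show False using \<open>A > 0\<close> by linarith
qed

text \<open>Raising \<open>p\<close> on \<open>{c..<d}\<close> can break monotonicity only at the
  right end, and a strict jump there (or \<open>d = n\<close>) leaves room for small steps.\<close>

lemma optimal_shift_up:
  fixes p :: "nat \<Rightarrow> real"
  assumes p: "mono_on {..<n} p"
    and opt: "\<And>u. mono_on {..<n} u \<Longrightarrow> quad_gain n x u \<le> quad_gain n x p"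
    and "d \<le> n" and gap: "d = n \<or> (0 < d \<and> p (d - 1) < p d)"
  shows "(\<Sum>l\<in>{c..<d}. x l - p l) \<le> 0"
proof -
  \<comment> \<open>Without a right neighbour any positive step is allowed; 1 is an arbitrary
    choice.\<close>
  define e0 where "e0 = (if d = n then 1 else p d - p (d - 1))"
  have "(\<Sum>l<n. (x l - p l) * (if l \<in> {c..<d} then 1 else 0)) \<le> 0"
  proof (rule optimal_variation[OF opt])
    show "e0 > 0" using gap by (auto simp: e0_def)
    fix e assume e: "0 < e" "e < e0"
    show "mono_on {..<n} (\<lambda>l. p l + e * (if l \<in> {c..<d} then 1 else 0))"
    proof (rule mono_onI)
      fix r s :: nat assume rs: "r \<in> {..<n}" "s \<in> {..<n}" "r \<le> s"
      have m: "p r \<le> p s" using mono_onD[OF p rs] .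
      show "p r + e * (if r \<in> {c..<d} then 1 else 0) \<le> p s + e * (if s \<in> {c..<d} then 1 else 0)"
      proof (cases "r \<in> {c..<d} \<and> s \<notin> {c..<d}")
        case True
        then have *: "r < d" "d \<le> s" using rs by auto
        then have "p r \<le> p (d - 1)" "p d \<le> p s" "d < n" using rs by (auto intro!: mono_onD[OF p])
        then show ?thesis using True e by (simp add: e0_def)
      next
        case False
        then show ?thesis using m e by auto
      qed
    qed
  qed
  also have "(\<Sum>l<n. (x l - p l) * (if l \<in> {c..<d} then 1 else 0)) = (\<Sum>l\<in>{..<n} \<inter> {c..<d}. x l - p l)"
    by (subst sum.inter_restrict) (auto intro: sum.cong)
  also have "{..<n} \<inter> {c..<d} = {c..<d}" using \<open>d \<le> n\<close> by auto
  finally show ?thesis .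
qed

text \<open>Mirror image of \<open>optimal_shift_up\<close>: lowering \<open>p\<close> on
  \<open>{c..<d}\<close> can break monotonicity only at the left end \<open>c\<close>.\<close>

lemma optimal_shift_down:
  fixes p :: "nat \<Rightarrow> real"
  assumes p: "mono_on {..<n} p"
    and opt: "\<And>u. mono_on {..<n} u \<Longrightarrow> quad_gain n x u \<le> quad_gain n x p"
    and "d \<le> n" and gap: "c = 0 \<or> (0 < c \<and> p (c - 1) < p c)"
  shows "(\<Sum>l\<in>{c..<d}. x l - p l) \<ge> 0"
proof -
  define e0 where "e0 = (if c = 0 then 1 else p c - p (c - 1))"
  have "(\<Sum>l<n. (x l - p l) * (if l \<in> {c..<d} then -1 else 0)) \<le> 0"
  proof (rule optimal_variation[OF opt])
    show "e0 > 0" using gap by (auto simp: e0_def)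
    fix e assume e: "0 < e" "e < e0"
    show "mono_on {..<n} (\<lambda>l. p l + e * (if l \<in> {c..<d} then -1 else 0))"
    proof (rule mono_onI)
      fix r s :: nat assume rs: "r \<in> {..<n}" "s \<in> {..<n}" "r \<le> s"
      have m: "p r \<le> p s" using mono_onD[OF p rs] .
      show "p r + e * (if r \<in> {c..<d} then -1 else 0) \<le> p s + e * (if s \<in> {c..<d} then -1 else 0)"
      proof (cases "s \<in> {c..<d} \<and> r \<notin> {c..<d}")
        case True
        then have *: "r < c" "c \<le> s" using rs by auto
        then have "p r \<le> p (c - 1)" "p c \<le> p s" using rs by (auto intro!: mono_onD[OF p])
        then show ?thesis using True e * by (simp add: e0_def)
      next
        case False
        then show ?thesis using m e by auto
      qed
    qed
  qed
  also have "(\<Sum>l<n. (x l - p l) * (if l \<in> {c..<d} then -1 else 0)) = (\<Sum>l\<in>{..<n} \<inter> {c..<d}. -(x l - p l))"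
    by (subst sum.inter_restrict) (auto intro: sum.cong)
  also have "{..<n} \<inter> {c..<d} = {c..<d}" using \<open>d \<le> n\<close> by auto
  finally show ?thesis by (simp add: sum_subtractf)
qed

text \<open>The level set of a monotone sequence is an interval, and being maximal it has strict
  jumps at both ends. These jumps are what the two shift lemmas ask for.\<close>

lemma level_block:
  fixes p :: "nat \<Rightarrow> real"
  assumes p: "mono_on {..<n} p" and "m < n"
  obtains i k where "i \<le> m" "m < i + k" "i + k \<le> n" "\<And>l. i \<le> l \<Longrightarrow> l < i + k \<Longrightarrow> p l = p m"
    "i = 0 \<or> (0 < i \<and> p (i - 1) < p i)" "i + k = n \<or> (0 < i + k \<and> p (i + k - 1) < p (i + k))"
proof -
  define L where "L = {l. l < n \<and> p l = p m}"
  have L: "finite L" "m \<in> L" using \<open>m < n\<close> by (auto simp: L_def)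
  define i j where "i = Min L" and "j = Max L"
  have i: "i \<in> L" "i \<le> m" and j: "j \<in> L" "m \<le> j"
    unfolding i_def j_def using L by (auto intro: Min_in Max_in)
  show thesis
  proof (rule that[of i "Suc j - i"])
    show "i \<le> m" by fact
    show "m < i + (Suc j - i)" "i + (Suc j - i) \<le> n" using i j by (auto simp: L_def)
    show "p l = p m" if "i \<le> l" "l < i + (Suc j - i)" for l
    proof -
      have "l \<le> j" "l < n" "i < n" "j < n" using that i j by (auto simp: L_def)
      then have "p i \<le> p l" "p l \<le> p j" using that by (auto intro!: mono_onD[OF p])
      then show ?thesis using i j by (auto simp: L_def)
    qed
    have "p (i - 1) < p i" if "0 < i"
    proof -
      have "p (i - 1) \<le> p i" using i \<open>m < n\<close> by (intro mono_onD[OF p]) auto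
      moreover have "i - 1 \<notin> L" using that Min_le[OF L(1), of "i - 1"] by (auto simp: i_def)
      ultimately show ?thesis using i by (auto simp: L_def)
    qed
    then show "i = 0 \<or> (0 < i \<and> p (i - 1) < p i)" by auto
    have e: "i + (Suc j - i) = Suc j" using i j by auto
    have "p j < p (Suc j)" if "Suc j < n"
    proof -
      have "p j \<le> p (Suc j)" using that by (auto simp: L_def intro!: mono_onD[OF p])
      moreover have "Suc j \<notin> L" using Max_ge[OF L(1), of "Suc j"] by (auto simp: j_def)
      ultimately show ?thesis using j that by (auto simp: L_def)
    qed
    then show "i + (Suc j - i) = n \<or>
        (0 < i + (Suc j - i) \<and> p (i + (Suc j - i) - 1) < p (i + (Suc j - i)))"
      unfolding e using j by (cases "Suc j = n") (auto simp: L_def)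
  qed
qed

section \<open>Deleting a level block from a sequence\<close>

definition prefix_mean :: "nat \<Rightarrow> (nat \<Rightarrow> real) \<Rightarrow> real" where
  "prefix_mean k w = (\<Sum>l<k. w l) / real k"

text \<open>Geometrically, the greatest convex minorant of the partial sums of the first
  \<open>k\<close> entries is a straight line, so that isotonic projection does not break these
  entries into several levels.\<close>

definition unbroken :: "nat \<Rightarrow> (nat \<Rightarrow> real) \<Rightarrow> bool" where
  "unbroken k w \<longleftrightarrow> (\<forall>j\<in>{..k}. 0 \<le> (\<Sum>l<j. w l - prefix_mean k w))"

definition strict_argmin :: "nat \<Rightarrow> nat \<Rightarrow> real \<Rightarrow> (nat \<Rightarrow> real) \<Rightarrow> bool" where
  "strict_argmin m i a h \<longleftrightarrow> (\<forall>j\<in>{..m}. j \<noteq> i \<longrightarrow> (\<Sum>l<i. h l - a) < (\<Sum>l<j. h l - a))"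

text \<open>Reindexing that moves the block \<open>{i..<i + k}\<close> to the front and keeps the order of the other indices.\<close>

definition block_first :: "nat \<Rightarrow> nat \<Rightarrow> nat \<Rightarrow> nat" where
  "block_first k i l = (if l < k then i + l else if l < k + i then l - k else l)"

text \<open>Take the level block of the maximiser \<open>p\<close> that contains \<open>m\<close>.
  Shifting \<open>p\<close> on pieces of the block controls the partial sums inside it; shifting
  pieces adjacent to it, where \<open>p\<close> differs strictly from the level, controls the walk
  of the remaining entries.\<close>

lemma optimal_block:
  fixes x :: "nat \<Rightarrow> real"
  assumes "m < n"
  obtains i k where "i \<le> m" "m < i + k" "i + k \<le> n"
    "unbroken k (x \<circ> block_first k i)"
    "strict_argmin (n - k) i (prefix_mean k (x \<circ> block_first k i)) (\<lambda>l. (x \<circ> block_first k i) (k + l))"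
    "mono_gain n x \<le> real k * (prefix_mean k (x \<circ> block_first k i))\<^sup>2
       + mono_gain (n - k) (\<lambda>l. (x \<circ> block_first k i) (k + l))"
proof -
  obtain p where p: "mono_on {..<n} p" and popt: "mono_gain n x = quad_gain n x p"
    using mono_gain_attained .
  have opt: "\<And>u. mono_on {..<n} u \<Longrightarrow> quad_gain n x u \<le> quad_gain n x p"
    using quad_gain_le_mono_gain popt by metis
  obtain i k where ik: "i \<le> m" "m < i + k" "i + k \<le> n"
    and lev: "\<And>l. i \<le> l \<Longrightarrow> l < i + k \<Longrightarrow> p l = p m"
    and left: "i = 0 \<or> (0 < i \<and> p (i - 1) < p i)"
    and right: "i + k = n \<or> (0 < i + k \<and> p (i + k - 1) < p (i + k))"
    using level_block[OF p \<open>m < n\<close>] by metis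
  define w h a where "w = x \<circ> block_first k i" and "h = (\<lambda>l. w (k + l))" and "a = p m"
  have "k > 0" using ik by simp
  have w: "w l = x (i + l)" if "l < k" for l using that by (simp add: w_def block_first_def)
  have h1: "h l = x l" if "l < i" for l using that by (simp add: w_def h_def block_first_def)
  have h2: "h l = x (k + l)" if "i \<le> l" for l using that by (simp add: w_def h_def block_first_def)
  have sumw: "(\<Sum>l<j. w l - b) = (\<Sum>l\<in>{i..<i+j}. x l - b)" if "j \<le> k" for j b
    using that sum.shift_bounds_nat_ivl[of "\<lambda>l. x l - b" 0 i j]
    by (simp add: w add.commute lessThan_atLeast0)
  have up: "(\<Sum>l\<in>{c..<d}. x l - p l) \<le> 0"
    if "d \<le> n" "d = n \<or> (0 < d \<and> p (d - 1) < p d)" for c d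
    by (rule optimal_shift_up[OF p opt that])
  have down: "(\<Sum>l\<in>{c..<d}. x l - p l) \<ge> 0"
    if "d \<le> n" "c = 0 \<or> (0 < c \<and> p (c - 1) < p c)" for c d
    by (rule optimal_shift_down[OF p opt that])
  have blk: "(\<Sum>l\<in>{i..<i+j}. x l - a) = (\<Sum>l\<in>{i..<i+j}. x l - p l)" if "j \<le> k" for j
    using that lev by (intro sum.cong) (auto simp: a_def)
  \<comment> \<open>The whole block has a jump at both ends and can be shifted either way, so its
    residuals sum to zero and its level is its mean.\<close>
  have "(\<Sum>l\<in>{i..<i+k}. x l - a) = 0"
    unfolding blk[OF order_refl] using up[of "i + k" i] down[of "i + k" i] ik left right by simp
  then have "(\<Sum>l<k. w l - a) = 0" using sumw by simp
  then have mean: "prefix_mean k w = a"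
    using \<open>k > 0\<close> by (simp add: prefix_mean_def sum_subtractf field_simps)
  have "unbroken k w"
    unfolding unbroken_def mean
  proof (safe)
    fix j assume "j \<le> k"
    then show "0 \<le> (\<Sum>l<j. w l - a)"
      using sumw blk down[of "i + j" i] left ik by simp
  qed
  moreover have "strict_argmin (n - k) i a h"
    unfolding strict_argmin_def
  proof (intro ballI impI)
    fix j assume j: "j \<in> {..n - k}" "j \<noteq> i"
    show "(\<Sum>l<i. h l - a) < (\<Sum>l<j. h l - a)"
    proof (cases "j < i")
      case True
      have "(\<Sum>l<i. h l - a) = (\<Sum>l<j. h l - a) + (\<Sum>l\<in>{j..<i}. h l - a)"
        using True by (simp add: lessThan_atLeast0 sum.atLeastLessThan_concat)
      \<comment> \<open>Left of the block, a piece ending at the jump can be raised, so its residual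
        sum is at most 0, and \<open>p\<close> lies strictly below \<open>a\<close> there.\<close>
      also have "(\<Sum>l\<in>{j..<i}. h l - a) = (\<Sum>l\<in>{j..<i}. x l - p l) + (\<Sum>l\<in>{j..<i}. p l - a)"
        unfolding sum.distrib[symmetric] by (intro sum.cong) (auto simp: h1)
      also have "(\<Sum>l\<in>{j..<i}. x l - p l) \<le> 0" using up[of i j] left True ik by auto
      also have "(\<Sum>l\<in>{j..<i}. p l - a) < 0"
      proof -
        have "(\<Sum>l\<in>{j..<i}. p l - a) < (\<Sum>l\<in>{j..<i}. 0)"
        proof (rule sum_strict_mono)
          fix l assume l: "l \<in> {j..<i}"
          then have "p l \<le> p (i - 1)" using ik by (auto intro!: mono_onD[OF p])
          also have "\<dots> < p i" using left l by auto
          also have "p i = a" using lev[of i] \<open>k > 0\<close> by (simp add: a_def)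
          finally show "p l - a < 0" by simp
        qed (use True in auto)
        then show ?thesis by simp
      qed
      finally show ?thesis by simp
    next
      case False
      then have "i < j" using j by simp
      then have "i + k < n" using j by auto
      have "(\<Sum>l<j. h l - a) = (\<Sum>l<i. h l - a) + (\<Sum>l\<in>{i..<j}. h l - a)"
        using False by (simp add: lessThan_atLeast0 sum.atLeastLessThan_concat)
      moreover have "(\<Sum>l\<in>{i..<j}. h l - a) = (\<Sum>l\<in>{i+k..<j+k}. x l - a)"
        unfolding sum.shift_bounds_nat_ivl by (intro sum.cong) (auto simp: h2 add.commute)
      \<comment> \<open>Right of the block, a piece starting at the jump can be lowered, so its
        residual sum is at least 0, and \<open>p\<close> lies strictly above \<open>a\<close>
        there.\<close>
      moreover have "(\<Sum>l\<in>{i+k..<j+k}. x l - a) = (\<Sum>l\<in>{i+k..<j+k}. x l - p l) + (\<Sum>l\<in>{i+k..<j+k}. p l - a)"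
        unfolding sum.distrib[symmetric] by (intro sum.cong) auto
      moreover have "(\<Sum>l\<in>{i+k..<j+k}. x l - p l) \<ge> 0" 
        using down[of "j + k" "i + k"] right \<open>i + k < n\<close> j by auto
      moreover have "(\<Sum>l\<in>{i+k..<j+k}. p l - a) > 0"
      proof (rule sum_pos)
        fix l assume l: "l \<in> {i+k..<j+k}"
        have "a = p (i + k - 1)" using lev[of "i + k - 1"] \<open>k > 0\<close> by (simp add: a_def)
        also have "\<dots> < p (i + k)" using right \<open>i + k < n\<close> by auto
        also have "\<dots> \<le> p l" using l j by (auto intro!: mono_onD[OF p])
        finally show "0 < p l - a" by simp
      qed (use \<open>i < j\<close> in auto)
      ultimately show ?thesis by linarith
    qed
  qed
  moreover have "mono_gain n x \<le> real k * a\<^sup>2 + mono_gain (n - k) h"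
  proof -
    \<comment> \<open>\<open>s\<close> enumerates the indices outside the block in increasing order,
      so \<open>p o s\<close> is a monotone competitor for the shortened sequence.\<close>
    define s where "s l = (if l < i then l else l + k)" for l
    define f where "f l = 2 * x l * p l - (p l)\<^sup>2" for l
    have hs: "h l = x (s l)" for l by (simp add: s_def h1 h2 add.commute)
    have "mono_on {..<n-k} (p \<circ> s)"
    proof (rule mono_onI)
      fix r q assume "r \<in> {..<n-k}" "q \<in> {..<n-k}" "r \<le> q"
      then show "(p \<circ> s) r \<le> (p \<circ> s) q" using ik by (auto simp: s_def intro!: mono_onD[OF p])
    qed
    then have "quad_gain (n - k) h (p \<circ> s) \<le> mono_gain (n - k) h" by (rule quad_gain_le_mono_gain)
    moreover have "quad_gain (n - k) h (p \<circ> s) = (\<Sum>l<i. f l) + (\<Sum>l\<in>{i+k..<n}. f l)"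
    proof -
      have "quad_gain (n - k) h (p \<circ> s) = (\<Sum>l<n-k. f (s l))"
        unfolding quad_gain_def f_def by (simp add: hs)
      also have "\<dots> = (\<Sum>l<i. f (s l)) + (\<Sum>l\<in>{i..<n-k}. f (s l))"
        using ik by (simp add: lessThan_atLeast0 sum.atLeastLessThan_concat)
      also have "(\<Sum>l<i. f (s l)) = (\<Sum>l<i. f l)" by (simp add: s_def)
      also have "(\<Sum>l\<in>{i..<n-k}. f (s l)) = (\<Sum>l\<in>{i+k..<(n-k)+k}. f l)"
        unfolding sum.shift_bounds_nat_ivl by (intro sum.cong) (auto simp: s_def)
      also have "n - k + k = n" using ik by simp
      finally show ?thesis .
    qed
    moreover have "quad_gain n x p = (\<Sum>l<i. f l) + (\<Sum>l\<in>{i..<i+k}. f l) + (\<Sum>l\<in>{i+k..<n}. f l)"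
      using ik unfolding quad_gain_def f_def[symmetric]
      by (simp add: lessThan_atLeast0 sum.atLeastLessThan_concat)
    moreover have "(\<Sum>l\<in>{i..<i+k}. f l) = real k * a\<^sup>2"
    proof -
      have "(\<Sum>l\<in>{i..<i+k}. f l) = (\<Sum>l\<in>{i..<i+k}. 2 * a * (x l - a) + a\<^sup>2)"
      proof (intro sum.cong refl)
        fix l assume "l \<in> {i..<i+k}"
        then have "p l = a" using lev[of l] by (simp add: a_def)
        then show "f l = 2 * a * (x l - a) + a\<^sup>2"
          by (simp add: f_def power2_eq_square algebra_simps)
      qed
      also have "\<dots> = 2 * a * (\<Sum>l\<in>{i..<i+k}. x l - a) + real k * a\<^sup>2"
        by (simp add: sum.distrib sum_distrib_left)
      finally show ?thesis using \<open>(\<Sum>l\<in>{i..<i+k}. x l - a) = 0\<close> by simp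
    qed
    ultimately show ?thesis using popt by simp
  qed
  ultimately show thesis using that[of i k] ik unfolding w_def[symmetric] h_def[symmetric] mean by blast
qed

section \<open>Independent standard normal sequences\<close>

abbreviation std_normal :: "real measure" where
  "std_normal \<equiv> density lborel (\<lambda>x. ennreal (std_normal_density x))"

interpretation std_normal: sequence_space std_normal
  by (simp add: sequence_space_def product_prob_space_def product_prob_space_axioms_def
      product_sigma_finite_def prob_space_normal_density prob_space_imp_sigma_finite)

text \<open>One infinite i.i.d. sequence serves every length \<open>n\<close> at once: each
  functional below reads only finitely many coordinates, so prefixes can be split off and tails
  shifted without changing the measure.\<close>

abbreviation gauss_seq :: "(nat \<Rightarrow> real) measure" where
  "gauss_seq \<equiv> PiM UNIV (\<lambda>_. std_normal)"

lemma sets_gauss_seq [measurable_cong]: "sets gauss_seq = sets borel"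
proof -
  have "sets gauss_seq = sets (PiM UNIV (\<lambda>_. borel))" by (intro sets_PiM_cong) auto
  then show ?thesis using sets_PiM_equal_borel by simp
qed

lemma space_gauss_seq [simp]: "space gauss_seq = UNIV"
  by (simp add: space_PiM)

lemma borel_measurable_seqI:
  "(\<And>i::nat. (\<lambda>x. f x i) \<in> borel_measurable M) \<Longrightarrow> f \<in> M \<rightarrow>\<^sub>M (borel :: (nat \<Rightarrow> real) measure)"
  by (rule measurable_coordinatewise_then_product)

lemma measurable_seq_shift [measurable]:
  "(\<lambda>w l. w (k + l)) \<in> (borel :: (nat \<Rightarrow> real) measure) \<rightarrow>\<^sub>M borel"
  by (rule borel_measurable_seqI) simp

lemma measurable_seq_comp:
  fixes f :: "nat \<Rightarrow> nat"
  shows "(\<lambda>w. w \<circ> f) \<in> (borel :: (nat \<Rightarrow> real) measure) \<rightarrow>\<^sub>M borel"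
  by (rule borel_measurable_seqI) simp

text \<open>Distinct coordinates of an i.i.d. sequence again form an i.i.d. sequence. This is
  applied to block moves, cyclic shifts and reversals.\<close>

lemma nn_integral_gauss_seq_reindex:
  fixes f :: "nat \<Rightarrow> nat"
  assumes "inj f" and [measurable]: "F \<in> borel_measurable borel"
  shows "(\<integral>\<^sup>+w. F (w \<circ> f) \<partial>gauss_seq) = (\<integral>\<^sup>+w. F w \<partial>gauss_seq)"
proof -
  have eq: "(\<lambda>w. \<lambda>n\<in>UNIV. w (f n)) = (\<lambda>w::nat\<Rightarrow>real. w \<circ> f)" by (auto simp: fun_eq_iff)
  have m: "(\<lambda>w. w \<circ> f) \<in> gauss_seq \<rightarrow>\<^sub>M gauss_seq"
    using measurable_seq_comp[of f] by (simp add: measurable_cong_sets[OF sets_gauss_seq sets_gauss_seq])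
  have "distr gauss_seq gauss_seq (\<lambda>w. w \<circ> f) = gauss_seq"
    using distr_PiM_reindex[of UNIV "\<lambda>_. std_normal" f UNIV] assms
    unfolding eq by (auto simp: prob_space_normal_density)
  then have "(\<integral>\<^sup>+w. F w \<partial>gauss_seq) = (\<integral>\<^sup>+w. F w \<partial>distr gauss_seq gauss_seq (\<lambda>w. w \<circ> f))" by simp
  also have "\<dots> = (\<integral>\<^sup>+w. F (w \<circ> f) \<partial>gauss_seq)"
    by (subst nn_integral_distr[OF m]) auto
  finally show ?thesis by simp
qed

text \<open>Independence of prefix and tail in Tonelli form: \<open>comb_seq k y h\<close> consists
  of the first \<open>k\<close> entries of \<open>y\<close> followed by all of
  \<open>h\<close>.\<close>

lemma nn_integral_gauss_seq_split:
  assumes [measurable]: "F \<in> borel_measurable borel"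
  shows "(\<integral>\<^sup>+w. F w \<partial>gauss_seq) = (\<integral>\<^sup>+y. \<integral>\<^sup>+h. F (comb_seq k y h) \<partial>gauss_seq \<partial>gauss_seq)"
proof -
  have "(\<integral>\<^sup>+w. F w \<partial>gauss_seq) = (\<integral>\<^sup>+w. F w \<partial>distr (gauss_seq \<Otimes>\<^sub>M gauss_seq) gauss_seq (\<lambda>(y, h). comb_seq k y h))"
    by (simp only: std_normal.PiM_comb_seq)
  also have "\<dots> = (\<integral>\<^sup>+yh. F (case yh of (y, h) \<Rightarrow> comb_seq k y h) \<partial>(gauss_seq \<Otimes>\<^sub>M gauss_seq))"
    by (subst nn_integral_distr) (auto intro: measurable_comb_seq)
  also have "\<dots> = (\<integral>\<^sup>+y. \<integral>\<^sup>+h. F (comb_seq k y h) \<partial>gauss_seq \<partial>gauss_seq)"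
  proof (subst std_normal.P.nn_integral_fst[symmetric])
    have "F \<in> borel_measurable gauss_seq" by simp
    then show "(\<lambda>yh. F (case yh of (y, h) \<Rightarrow> comb_seq k y h)) \<in> borel_measurable (gauss_seq \<Otimes>\<^sub>M gauss_seq)"
      by (rule measurable_compose[OF measurable_comb_seq])
  qed simp
  finally show ?thesis .
qed

lemma AE_gauss_seq_coordinate_neq: "AE h in gauss_seq. h i \<noteq> c"
proof -
  have "AE x in std_normal. x \<noteq> c"
    by (subst AE_density) (auto intro: AE_mp[OF AE_lborel_singleton])
  then show ?thesis
    by (intro AE_PiM_component[of UNIV "\<lambda>_. std_normal" i "\<lambda>x. x \<noteq> c"])
      (auto simp: prob_space_normal_density)
qed

lemma borel_measurable_prefix_mean [measurable]: "prefix_mean k \<in> borel_measurable borel"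
  unfolding prefix_mean_def by measurable

lemma measurable_unbroken [measurable]: "Measurable.pred borel (unbroken k)"
  unfolding unbroken_def by measurable

lemma AE_arc_sum_neq_zero:
  assumes "r < q" "q < k"
  shows "AE w in gauss_seq. (\<Sum>l\<in>{r..<q}. w l - prefix_mean k w) \<noteq> 0"
proof -
  \<comment> \<open>Conditionally on the other coordinates, the last one is determined by the equation.\<close>
  define m where "m = k - 1"
  have k: "k = Suc m" and q: "q \<le> m" using assms by (auto simp: m_def)
  define B where "B = {w. (\<Sum>l\<in>{r..<q}. w l - prefix_mean k w) = 0}"
  have [measurable]: "B \<in> sets borel" unfolding B_def by measurable
  have "(\<integral>\<^sup>+h. indicator B (comb_seq m y h) \<partial>gauss_seq) = 0" for y :: "nat \<Rightarrow> real"
  proof -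
    \<comment> \<open>Since \<open>q < k\<close>, the last of the \<open>k\<close> entries enters
      the equation only through the mean, with a nonzero coefficient; \<open>c\<close> is the
      solution for that entry.\<close>
    define c where "c = (\<Sum>l\<in>{r..<q}. y l) * real k / real (q - r) - (\<Sum>l<m. y l)"
    have "h 0 = c" if "comb_seq m y h \<in> B" for h
    proof -
      have s1: "(\<Sum>l\<in>{r..<q}. comb_seq m y h l) = (\<Sum>l\<in>{r..<q}. y l)"
        using q by (intro sum.cong) (auto simp: comb_seq_def)
      have s2: "(\<Sum>l<k. comb_seq m y h l) = (\<Sum>l<m. y l) + h 0"
        unfolding k by (simp add: comb_seq_def)
      have "(\<Sum>l\<in>{r..<q}. y l) = real (q - r) * (((\<Sum>l<m. y l) + h 0) / real k)"
        using that assms unfolding B_def mem_Collect_eq sum_subtractf s1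
        by (simp add: prefix_mean_def s2)
      then show ?thesis using assms k unfolding c_def by (simp add: field_simps)
    qed
    then have "AE h in gauss_seq. indicator B (comb_seq m y h) = (0::ennreal)"
      using AE_gauss_seq_coordinate_neq[of 0 c] by (auto elim!: eventually_mono simp: indicator_def)
    then have "(\<integral>\<^sup>+h. indicator B (comb_seq m y h) \<partial>gauss_seq) = (\<integral>\<^sup>+h. 0 \<partial>gauss_seq)"
      by (rule nn_integral_cong_AE)
    then show ?thesis by simp
  qed
  then have "(\<integral>\<^sup>+w. indicator B w \<partial>gauss_seq) = 0"
    by (subst nn_integral_gauss_seq_split[of _ m]) auto
  then have "AE w in gauss_seq. indicator B w = (0::ennreal)"
    by (subst (asm) nn_integral_0_iff_AE) auto
  then show ?thesis by (auto elim!: eventually_mono simp: B_def indicator_def split: if_splits)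
qed

section \<open>Cycle lemma for cyclic shifts\<close>

definition cyclic_shift :: "nat \<Rightarrow> nat \<Rightarrow> nat \<Rightarrow> nat" where
  "cyclic_shift k r l = (if l < k then (l + r) mod k else l)"

lemma inj_cyclic_shift: "inj (cyclic_shift k r)"
proof (rule injI)
  have *: "a = b" if "a \<le> b" "b < k" "(a + r) mod k = (b + r) mod k" for a b
  proof -
    have "k dvd (b + r) - (a + r)" using that by (subst mod_eq_dvd_iff_nat[symmetric]) auto
    then have "k dvd b - a" by simp
    then have "b - a = 0" using that(2) nat_dvd_not_less[of "b - a" k] by (cases "b - a = 0") auto
    then show ?thesis using that(1) by simp
  qed
  fix a b assume eq: "cyclic_shift k r a = cyclic_shift k r b"
  consider "a < k" "b < k" | "a \<ge> k" "b \<ge> k" | "a < k" "b \<ge> k" | "a \<ge> k" "b < k" by linarith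
  then show "a = b"
  proof cases
    case 1
    then show ?thesis using eq *[of a b] *[of b a]
      by (cases "a \<le> b") (auto simp: cyclic_shift_def)
  next
    case 3
    then have "b = (a + r) mod k" using eq by (simp add: cyclic_shift_def)
    then have "b < k" using 3 by simp
    then show ?thesis using 3 by simp
  next
    case 4
    then have "a = (b + r) mod k" using eq by (simp add: cyclic_shift_def)
    then have "a < k" using 4 by simp
    then show ?thesis using 4 by simp
  qed (use eq in \<open>auto simp: cyclic_shift_def\<close>)
qed

lemma prefix_mean_cyclic_shift: "prefix_mean k (w \<circ> cyclic_shift k r) = prefix_mean k w"
proof -
  have "cyclic_shift k r ` {..<k} \<subseteq> {..<k}"
    by (auto simp: cyclic_shift_def)
  then have "cyclic_shift k r ` {..<k} = {..<k}"
    by (intro endo_inj_surj inj_on_subset[OF inj_cyclic_shift]) auto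
  then have "sum w {..<k} = sum (w \<circ> cyclic_shift k r) {..<k}"
    using sum.reindex[OF inj_on_subset[OF inj_cyclic_shift[of k r], of "{..<k}"], of w] by simp
  then show ?thesis by (simp add: prefix_mean_def)
qed

text \<open>The two starting points cut the circle into two arcs. Each arc is an initial piece of
  one of the two shifts, so both centred sums are nonnegative; they add up to 0, hence both
  vanish.\<close>

lemma unbroken_cyclic_shifts_tie:
  assumes "r < q" "q < k" "unbroken k (w \<circ> cyclic_shift k r)" "unbroken k (w \<circ> cyclic_shift k q)"
  shows "(\<Sum>l\<in>{r..<q}. w l - prefix_mean k w) = 0"
proof -
  define v where "v l = w l - prefix_mean k w" for l
  have pos: "0 \<le> (\<Sum>l<j. v (cyclic_shift k s l))"
    if "unbroken k (w \<circ> cyclic_shift k s)" "j \<le> k" for j s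
    using that unfolding unbroken_def prefix_mean_cyclic_shift v_def by auto
  have tot: "(\<Sum>l<k. v l) = 0"
    using assms by (simp add: v_def prefix_mean_def sum_subtractf)
  have "(\<Sum>l<q-r. v (cyclic_shift k r l)) = (\<Sum>l<q-r. v (l + r))"
    using assms by (intro sum.cong) (auto simp: cyclic_shift_def)
  also have "\<dots> = (\<Sum>l\<in>{r..<q}. v l)"
    using sum.shift_bounds_nat_ivl[of v 0 r "q - r"] assms by (simp add: lessThan_atLeast0)
  finally have 1: "0 \<le> (\<Sum>l\<in>{r..<q}. v l)" using pos[OF assms(3), of "q - r"] assms by simp
  \<comment> \<open>The arc from \<open>q\<close> to \<open>r\<close> wraps around:
    \<open>k - q\<close> entries up to the end, then the first \<open>r\<close> entries.\<close>
  have "(\<Sum>l<(k-q)+r. v (cyclic_shift k q l))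
      = (\<Sum>l<k-q. v (cyclic_shift k q l)) + (\<Sum>l\<in>{k-q..<(k-q)+r}. v (cyclic_shift k q l))"
    by (simp add: lessThan_atLeast0 sum.atLeastLessThan_concat)
  also have "(\<Sum>l<k-q. v (cyclic_shift k q l)) = (\<Sum>l<k-q. v (l + q))"
    using assms by (intro sum.cong) (auto simp: cyclic_shift_def)
  also have "\<dots> = (\<Sum>l\<in>{q..<k}. v l)"
    using sum.shift_bounds_nat_ivl[of v 0 q "k - q"] assms by (simp add: lessThan_atLeast0)
  also have "(\<Sum>l\<in>{k-q..<(k-q)+r}. v (cyclic_shift k q l)) = (\<Sum>l\<in>{0..<r}. v (cyclic_shift k q (l + (k - q))))"
    using sum.shift_bounds_nat_ivl[of "\<lambda>l. v (cyclic_shift k q l)" 0 "k - q" r] by (simp add: add.commute)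
  also have "\<dots> = (\<Sum>l\<in>{0..<r}. v l)"
    using assms by (intro sum.cong) (auto simp: cyclic_shift_def)
  finally have 2: "0 \<le> (\<Sum>l\<in>{q..<k}. v l) + (\<Sum>l\<in>{0..<r}. v l)"
    using pos[OF assms(4), of "k - q + r"] assms by simp
  have "(\<Sum>l<k. v l) = (\<Sum>l\<in>{0..<r}. v l) + (\<Sum>l\<in>{r..<q}. v l) + (\<Sum>l\<in>{q..<k}. v l)"
    using assms by (simp add: lessThan_atLeast0 sum.atLeastLessThan_concat)
  then have "(\<Sum>l\<in>{r..<q}. v l) = 0" using 1 2 tot by linarith
  then show ?thesis by (simp add: v_def)
qed

text \<open>Two unbroken shifts would force a vanishing arc sum, which is a null event for each of
  the finitely many pairs. This is the uniqueness half of the cycle lemma, the half that yields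
  upper bounds.\<close>

lemma AE_unique_unbroken_shift:
  "AE w in gauss_seq. (\<Sum>r<k. of_bool (unbroken k (w \<circ> cyclic_shift k r))) \<le> (1::ennreal)"
proof -
  have "AE w in gauss_seq. \<forall>r\<in>{..<k}. \<forall>q\<in>{..<k}. r < q \<longrightarrow> (\<Sum>l\<in>{r..<q}. w l - prefix_mean k w) \<noteq> 0"
    using AE_arc_sum_neq_zero by (intro AE_finite_allI finite_lessThan AE_impI) auto
  then show ?thesis
  proof (rule eventually_mono)
    fix w :: "nat \<Rightarrow> real"
    assume w: "\<forall>r\<in>{..<k}. \<forall>q\<in>{..<k}. r < q \<longrightarrow> (\<Sum>l\<in>{r..<q}. w l - prefix_mean k w) \<noteq> 0"
    define R where "R = {r\<in>{..<k}. unbroken k (w \<circ> cyclic_shift k r)}"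
    have "r = q" if "r \<in> R" "q \<in> R" for r q
      using that w unbroken_cyclic_shifts_tie[of r q k w] unbroken_cyclic_shifts_tie[of q r k w]
      by (cases r q rule: linorder_cases) (auto simp: R_def)
    then have "card R \<le> 1" by (auto simp: card_le_Suc0_iff_eq R_def)
    moreover have "(\<Sum>r<k. of_bool (unbroken k (w \<circ> cyclic_shift k r))) = (of_nat (card R) :: ennreal)"
      by (simp add: R_def of_bool_def sum.If_cases Int_def)
    ultimately show "(\<Sum>r<k. of_bool (unbroken k (w \<circ> cyclic_shift k r))) \<le> (1::ennreal)"
      by (metis of_nat_1 of_nat_mono)
  qed
qed

section \<open>Exponential moment of a single block\<close>

lemma distributed_prefix_sum:
  assumes "k > 0"
  shows "distributed gauss_seq lborel (\<lambda>w. \<Sum>l<k. w l) (normal_density 0 (sqrt (real k)))"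
proof -
  have comp: "distr gauss_seq std_normal (\<lambda>w. w i) = std_normal" for i
    using distr_PiM_component[of UNIV "\<lambda>_. std_normal" i] by (simp add: prob_space_normal_density)
  then have comp': "distr gauss_seq borel (\<lambda>w. w i) = std_normal" for i
    by (metis (no_types, lifting) distr_cong sets_density sets_lborel)
  have "std_normal.indep_vars (\<lambda>_. borel) (\<lambda>i w. w i) {..<k}"
  proof (subst std_normal.indep_vars_iff_distr_eq_PiM')
    have eq: "sets (PiM {..<k} (\<lambda>_. borel)) = sets (PiM {..<k} (\<lambda>_. std_normal))"
      by (intro sets_PiM_cong) auto
    have "distr gauss_seq (PiM {..<k} (\<lambda>_. std_normal)) (\<lambda>w. \<lambda>i\<in>{..<k}. w i) = PiM {..<k} (\<lambda>_. std_normal)"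
      using distr_PiM_reindex[of UNIV "\<lambda>_. std_normal" "\<lambda>i. i" "{..<k}"] by (simp add: prob_space_normal_density)
    then show "distr gauss_seq (PiM {..<k} (\<lambda>_. borel)) (\<lambda>w. \<lambda>i\<in>{..<k}. w i)
        = (\<Pi>\<^sub>M i\<in>{..<k}. distr gauss_seq borel (\<lambda>w. w i))"
      unfolding comp' using distr_cong[OF refl eq] by metis
  qed (use assms in auto)
  then have "distributed gauss_seq lborel (\<lambda>w. \<Sum>l\<in>{..<k}. w l)
      (normal_density (\<Sum>l\<in>{..<k}. 0) (sqrt (\<Sum>l\<in>{..<k}. 1\<^sup>2)))"
  proof (rule std_normal.sum_indep_normal[rotated 2])
    fix i
    have "distr gauss_seq lborel (\<lambda>w. w i) = distr gauss_seq borel (\<lambda>w. w i)"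
      by (rule distr_cong) auto
    then show "distributed gauss_seq lborel (\<lambda>w. w i) (\<lambda>x. ennreal (std_normal_density x))"
      using comp'[of i] by (auto simp: distributed_def)
  qed (use assms in auto)
  then show ?thesis by simp
qed

text \<open>The quantity in the exponent is 3/8 times the square of a standard normal, whose
  exponential moment is (1 - 2 * 3/8)^(-1/2) = 2. With this value the recursion for the isotonic
  moments is solved by \<open>n + 1\<close>.\<close>

lemma nn_integral_exp_prefix_mean:
  assumes "k > 0"
  shows "(\<integral>\<^sup>+w. ennreal (exp (3/8 * (real k * (prefix_mean k w)\<^sup>2))) \<partial>gauss_seq) = 2"
proof -
  define G where "G s = ennreal (exp (3/8 * (s\<^sup>2 / real k)))" for s
  have [measurable]: "G \<in> borel_measurable borel" unfolding G_def by measurable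
  have "(\<integral>\<^sup>+w. ennreal (exp (3/8 * (real k * (prefix_mean k w)\<^sup>2))) \<partial>gauss_seq)
      = (\<integral>\<^sup>+w. G (\<Sum>l<k. w l) \<partial>gauss_seq)"
    using assms by (simp add: G_def prefix_mean_def power2_eq_square)
  also have "\<dots> = (\<integral>\<^sup>+s. ennreal (normal_density 0 (sqrt (real k)) s) * G s \<partial>lborel)"
    by (subst distributed_nn_integral[OF distributed_prefix_sum[OF assms]]) auto
  \<comment> \<open>As 1/2 - 3/8 = 1/8, tilting turns the density of variance \<open>k\<close> into
    one of variance \<open>4 * k\<close>, up to the ratio 2 of the normalising constants.\<close>
  also have "\<dots> = (\<integral>\<^sup>+s. 2 * ennreal (normal_density 0 (2 * sqrt (real k)) s) \<partial>lborel)"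
  proof (intro nn_integral_cong)
    fix s :: real
    have "exp (- (s\<^sup>2 / (2 * real k))) * exp (3/8 * (s\<^sup>2 / real k)) = exp (- (s\<^sup>2 / (8 * real k)))"
      unfolding exp_add[symmetric] using assms by (simp add: field_simps)
    moreover have "sqrt (2 * pi * (2 * sqrt (real k))\<^sup>2) = 2 * sqrt (2 * pi * real k)"
    proof -
      have "2 * pi * (2 * sqrt (real k))\<^sup>2 = 2\<^sup>2 * (2 * pi * real k)" by (simp add: power_mult_distrib)
      then show ?thesis by (simp only: real_sqrt_mult real_sqrt_abs abs_numeral)
    qed
    ultimately have "normal_density 0 (sqrt (real k)) s * exp (3/8 * (s\<^sup>2 / real k))
        = 2 * normal_density 0 (2 * sqrt (real k)) s"
      by (simp add: normal_density_def power_mult_distrib)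
    then show "ennreal (normal_density 0 (sqrt (real k)) s) * G s
        = 2 * ennreal (normal_density 0 (2 * sqrt (real k)) s)"
      unfolding G_def by (simp add: ennreal_mult'[symmetric]) (simp add: ennreal_mult')
  qed
  also have "\<dots> = 2 * (\<integral>\<^sup>+s. ennreal (normal_density 0 (2 * sqrt (real k)) s) \<partial>lborel)"
    by (rule nn_integral_cmult) simp
  also have "(\<integral>\<^sup>+s. ennreal (normal_density 0 (2 * sqrt (real k)) s) \<partial>lborel) = 1"
    using assms by (subst nn_integral_eq_integral) (auto intro: integrable_normal_density)
  finally show ?thesis by simp
qed

text \<open>Cyclic shifts preserve both the law and the mean, so the factor \<open>k\<close> can be
  spread over the \<open>k\<close> shifts, of which almost surely at most one is unbroken.\<close>

lemma nn_integral_unbroken: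
  assumes "k > 0"
  shows "of_nat k * (\<integral>\<^sup>+w. of_bool (unbroken k w) * ennreal (exp (3/8 * (real k * (prefix_mean k w)\<^sup>2))) \<partial>gauss_seq) \<le> 2"
proof -
  define f where "f w = of_bool (unbroken k w) * ennreal (exp (3/8 * (real k * (prefix_mean k w)\<^sup>2)))" for w
  have [measurable]: "f \<in> borel_measurable borel" unfolding f_def by measurable
  have [measurable]: "(\<lambda>w. f (w \<circ> cyclic_shift k r)) \<in> borel_measurable gauss_seq" for r
    using measurable_compose[OF measurable_seq_comp[of "cyclic_shift k r"], of f] by simp
  have "of_nat k * (\<integral>\<^sup>+w. f w \<partial>gauss_seq) = (\<Sum>r<k. (\<integral>\<^sup>+w. f (w \<circ> cyclic_shift k r) \<partial>gauss_seq))"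
    by (simp add: nn_integral_gauss_seq_reindex[OF inj_cyclic_shift])
  also have "\<dots> = (\<integral>\<^sup>+w. (\<Sum>r<k. f (w \<circ> cyclic_shift k r)) \<partial>gauss_seq)"
    by (rule nn_integral_sum[symmetric]) simp
  also have "\<dots> \<le> (\<integral>\<^sup>+w. ennreal (exp (3/8 * (real k * (prefix_mean k w)\<^sup>2))) \<partial>gauss_seq)"
  proof (rule nn_integral_mono_AE, use AE_unique_unbroken_shift[of k] in eventually_elim)
    case (elim w)
    have "(\<Sum>r<k. f (w \<circ> cyclic_shift k r))
        = (\<Sum>r<k. of_bool (unbroken k (w \<circ> cyclic_shift k r))) * ennreal (exp (3/8 * (real k * (prefix_mean k w)\<^sup>2)))"
      by (simp add: f_def prefix_mean_cyclic_shift sum_distrib_right)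
    also have "\<dots> \<le> 1 * ennreal (exp (3/8 * (real k * (prefix_mean k w)\<^sup>2)))"
      by (intro mult_right_mono elim) simp
    finally show ?case by simp
  qed
  also have "\<dots> = 2" by (rule nn_integral_exp_prefix_mean[OF assms])
  finally show ?thesis unfolding f_def .
qed

section \<open>Exponential moment of the isotonic projection\<close>

lemma measurable_strict_argmin:
  assumes [measurable]: "a \<in> borel_measurable M" "h \<in> M \<rightarrow>\<^sub>M borel"
  shows "Measurable.pred M (\<lambda>w. strict_argmin m i (a w) (h w))"
proof -
  have [measurable]: "(\<lambda>w. h w l) \<in> borel_measurable M" for l
    using measurable_compose[OF assms(2) measurable_product_coordinates[of l]] .
  show ?thesis unfolding strict_argmin_def by measurable
qed

text \<open>Two strict minimisers would each lie below the other. Hence the remaining entries and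
  the mean of a deleted block leave at most one position for that block.\<close>

lemma sum_strict_argmin_le: "(\<Sum>i\<le>m. of_bool (strict_argmin m i a h)) \<le> (1::ennreal)"
proof -
  define R where "R = {i\<in>{..m}. strict_argmin m i a h}"
  have "r = q" if "r \<in> R" "q \<in> R" for r q
  proof (rule ccontr)
    assume "r \<noteq> q"
    then have "(\<Sum>l<r. h l - a) < (\<Sum>l<q. h l - a)" "(\<Sum>l<q. h l - a) < (\<Sum>l<r. h l - a)"
      using that by (simp_all add: R_def strict_argmin_def)
    then show False by simp
  qed
  then have "card R \<le> 1" by (auto simp: card_le_Suc0_iff_eq R_def)
  moreover have "(\<Sum>i\<le>m. of_bool (strict_argmin m i a h)) = (of_nat (card R) :: ennreal)"
    by (simp add: R_def of_bool_def sum.If_cases Int_def)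
  ultimately show ?thesis by (metis of_nat_1 of_nat_mono)
qed

text \<open>Valued in \<open>ennreal\<close>, so that Tonelli and the recursion apply before the
  moment is known to be finite.\<close>

definition exp_gain :: "nat \<Rightarrow> (nat \<Rightarrow> real) \<Rightarrow> ennreal" where
  "exp_gain n w = ennreal (exp (3/8 * mono_gain n w))"

lemma borel_measurable_exp_gain [measurable]: "exp_gain n \<in> borel_measurable borel"
  using borel_measurable_mono_gain[of n] unfolding exp_gain_def by measurable

definition block_weight :: "nat \<Rightarrow> (nat \<Rightarrow> real) \<Rightarrow> ennreal" where
  "block_weight k w = of_bool (unbroken k w) * ennreal (exp (3/8 * (real k * (prefix_mean k w)\<^sup>2)))"

definition rest_weight :: "nat \<Rightarrow> nat \<Rightarrow> real \<Rightarrow> (nat \<Rightarrow> real) \<Rightarrow> ennreal" where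
  "rest_weight m i a h = of_bool (strict_argmin m i a h) * exp_gain m h"

lemma borel_measurable_block_weight [measurable]: "block_weight k \<in> borel_measurable borel"
  unfolding block_weight_def by measurable

lemma borel_measurable_rest_weight:
  assumes [measurable]: "a \<in> borel_measurable M" "h \<in> M \<rightarrow>\<^sub>M borel"
  shows "(\<lambda>w. rest_weight m i (a w) (h w)) \<in> borel_measurable M"
  using measurable_strict_argmin[OF assms, of m i] unfolding rest_weight_def by measurable

text \<open>The argument is a sequence whose block has already been moved to the front; block and
  remainder then interact only through the mean passed to \<open>rest_weight\<close>.\<close>

definition split_weight :: "nat \<Rightarrow> nat \<Rightarrow> nat \<Rightarrow> (nat \<Rightarrow> real) \<Rightarrow> ennreal" where
  "split_weight n k i w = block_weight k w * rest_weight (n - k) i (prefix_mean k w) (\<lambda>l. w (k + l))"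

lemma borel_measurable_split_weight [measurable]: "split_weight n k i \<in> borel_measurable borel"
  using borel_measurable_rest_weight[OF borel_measurable_prefix_mean[of k] measurable_seq_shift[of k], of "n - k" i]
  unfolding split_weight_def by measurable

text \<open>Double counting: every \<open>m < n\<close> lies in an optimal block whose weight
  dominates \<open>exp_gain n x\<close>, and summing over \<open>m\<close> counts each candidate
  block once per element, that is \<open>k\<close> times.\<close>

lemma exp_gain_le_block_sum:
  "of_nat n * exp_gain n x
     \<le> (\<Sum>k\<in>{1..n}. \<Sum>i\<le>n-k. of_nat k * split_weight n k i (x \<circ> block_first k i))"
proof -
  define T where "T k i = split_weight n k i (x \<circ> block_first k i)" for k i
  have m: "exp_gain n x \<le> (\<Sum>k\<in>{1..n}. \<Sum>i\<le>n-k. of_bool (i \<le> m \<and> m < i + k) * T k i)"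
    if "m < n" for m
  proof -
    obtain i k where ik: "i \<le> m" "m < i + k" "i + k \<le> n"
      and 1: "unbroken k (x \<circ> block_first k i)"
      and 2: "strict_argmin (n - k) i (prefix_mean k (x \<circ> block_first k i)) (\<lambda>l. (x \<circ> block_first k i) (k + l))"
      and 3: "mono_gain n x \<le> real k * (prefix_mean k (x \<circ> block_first k i))\<^sup>2
       + mono_gain (n - k) (\<lambda>l. (x \<circ> block_first k i) (k + l))"
      by (rule optimal_block[OF \<open>m < n\<close>])
    have "exp_gain n x \<le> ennreal (exp (3/8 * (real k * (prefix_mean k (x \<circ> block_first k i))\<^sup>2)
       + 3/8 * mono_gain (n - k) (\<lambda>l. (x \<circ> block_first k i) (k + l))))"
      unfolding exp_gain_def using 3 by (intro ennreal_leI) simp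
    also have "\<dots> = T k i"
      unfolding T_def split_weight_def block_weight_def rest_weight_def exp_gain_def exp_add
      using 1 2 by (simp add: ennreal_mult)
    also have "\<dots> = of_bool (i \<le> m \<and> m < i + k) * T k i" using ik by simp
    also have "\<dots> \<le> (\<Sum>i\<le>n-k. of_bool (i \<le> m \<and> m < i + k) * T k i)"
      using ik by (intro member_le_sum) auto
    also have "\<dots> \<le> (\<Sum>k\<in>{1..n}. \<Sum>i\<le>n-k. of_bool (i \<le> m \<and> m < i + k) * T k i)"
      using ik by (intro member_le_sum[of k "{1..n}" "\<lambda>k. \<Sum>i\<le>n-k. of_bool (i \<le> m \<and> m < i + k) * T k i"]) auto
    finally show ?thesis .
  qed
  have "of_nat n * exp_gain n x = (\<Sum>m<n. exp_gain n x)" by simp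
  also have "\<dots> \<le> (\<Sum>m<n. \<Sum>k\<in>{1..n}. \<Sum>i\<le>n-k. of_bool (i \<le> m \<and> m < i + k) * T k i)"
    by (intro sum_mono m) simp
  also have "\<dots> = (\<Sum>k\<in>{1..n}. \<Sum>m<n. \<Sum>i\<le>n-k. of_bool (i \<le> m \<and> m < i + k) * T k i)"
    by (rule sum.swap)
  also have "\<dots> = (\<Sum>k\<in>{1..n}. \<Sum>i\<le>n-k. \<Sum>m<n. of_bool (i \<le> m \<and> m < i + k) * T k i)"
    by (intro sum.cong refl sum.swap)
  also have "\<dots> = (\<Sum>k\<in>{1..n}. \<Sum>i\<le>n-k. of_nat k * T k i)"
  proof (intro sum.cong refl)
    fix k i assume "k \<in> {1..n}" "i \<in> {..n-k}"
    then have "{m \<in> {..<n}. i \<le> m \<and> m < i + k} = {i..<i+k}" by auto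
    then have "(\<Sum>m<n. of_bool (i \<le> m \<and> m < i + k)) = (of_nat k :: ennreal)"
      by (simp add: of_bool_def sum.If_cases Int_def)
    then show "(\<Sum>m<n. of_bool (i \<le> m \<and> m < i + k) * T k i) = of_nat k * T k i"
      by (simp add: sum_distrib_right[symmetric])
  qed
  finally show ?thesis unfolding T_def .
qed

lemma inj_block_first: "inj (block_first k i)"
  by (rule injI) (auto simp: block_first_def split: if_splits)

lemma prefix_mean_comb_seq: "prefix_mean k (comb_seq k y h) = prefix_mean k y"
  unfolding prefix_mean_def by (intro arg_cong2[where f = "(/)"] sum.cong) (auto simp: comb_seq_def)

lemma unbroken_comb_seq: "unbroken k (comb_seq k y h) = unbroken k y"
proof -
  have "(\<Sum>l<j. comb_seq k y h l - c) = (\<Sum>l<j. y l - c)" if "j \<le> k" for j c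
    using that by (intro sum.cong) (auto simp: comb_seq_def)
  then show ?thesis unfolding unbroken_def prefix_mean_comb_seq by auto
qed

text \<open>After reindexing, the block is the prefix and the remainder an independent tail. For a
  fixed block mean the indicators of the possible positions add up to at most 1, which decouples the
  two factors.\<close>

lemma sum_nn_integral_split_weight:
  "(\<Sum>i\<le>n-k. \<integral>\<^sup>+x. split_weight n k i (x \<circ> block_first k i) \<partial>gauss_seq)
     \<le> (\<integral>\<^sup>+y. block_weight k y \<partial>gauss_seq) * (\<integral>\<^sup>+h. exp_gain (n - k) h \<partial>gauss_seq)"
proof -
  have [measurable]: "(\<lambda>h. rest_weight m i a h) \<in> borel_measurable gauss_seq" for m i a
    by (intro borel_measurable_rest_weight) simp_all
  have "(\<Sum>i\<le>n-k. \<integral>\<^sup>+x. split_weight n k i (x \<circ> block_first k i) \<partial>gauss_seq)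
      = (\<Sum>i\<le>n-k. \<integral>\<^sup>+x. split_weight n k i x \<partial>gauss_seq)"
    by (simp add: nn_integral_gauss_seq_reindex[OF inj_block_first])
  also have "\<dots> = (\<integral>\<^sup>+x. (\<Sum>i\<le>n-k. split_weight n k i x) \<partial>gauss_seq)"
    by (rule nn_integral_sum[symmetric]) simp
  also have "\<dots> = (\<integral>\<^sup>+y. \<integral>\<^sup>+h. (\<Sum>i\<le>n-k. split_weight n k i (comb_seq k y h)) \<partial>gauss_seq \<partial>gauss_seq)"
    by (rule nn_integral_gauss_seq_split) simp
  also have "\<dots> = (\<integral>\<^sup>+y. \<integral>\<^sup>+h. block_weight k y * (\<Sum>i\<le>n-k. rest_weight (n - k) i (prefix_mean k y) h) \<partial>gauss_seq \<partial>gauss_seq)"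
    by (simp add: split_weight_def block_weight_def unbroken_comb_seq prefix_mean_comb_seq
        sum_distrib_left comb_seq_def)
  also have "\<dots> \<le> (\<integral>\<^sup>+y. \<integral>\<^sup>+h. block_weight k y * exp_gain (n - k) h \<partial>gauss_seq \<partial>gauss_seq)"
  proof (intro nn_integral_mono mult_left_mono)
    fix a h
    have "(\<Sum>i\<le>n-k. rest_weight (n - k) i a h) = (\<Sum>i\<le>n-k. of_bool (strict_argmin (n - k) i a h)) * exp_gain (n - k) h"
      by (simp add: rest_weight_def sum_distrib_right)
    also have "\<dots> \<le> 1 * exp_gain (n - k) h" by (intro mult_right_mono sum_strict_argmin_le) simp
    finally show "(\<Sum>i\<le>n-k. rest_weight (n - k) i a h) \<le> exp_gain (n - k) h" by simp
  qed simp
  also have "\<dots> = (\<integral>\<^sup>+y. block_weight k y \<partial>gauss_seq) * (\<integral>\<^sup>+h. exp_gain (n - k) h \<partial>gauss_seq)"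
    by (simp add: nn_integral_cmult nn_integral_multc)
  finally show ?thesis .
qed

text \<open>The multiplicity \<open>k\<close> from the double count is absorbed by the probability
  \<open>1/k\<close> hidden in \<open>nn_integral_unbroken\<close>, leaving the constant 2.\<close>

lemma nn_integral_exp_gain_recursion:
  "of_nat n * (\<integral>\<^sup>+x. exp_gain n x \<partial>gauss_seq)
     \<le> (\<Sum>k\<in>{1..n}. 2 * (\<integral>\<^sup>+x. exp_gain (n - k) x \<partial>gauss_seq))"
proof -
  have [measurable]: "(\<lambda>x. split_weight n k i (x \<circ> block_first k i)) \<in> borel_measurable gauss_seq" for k i
    using measurable_compose[OF measurable_seq_comp borel_measurable_split_weight] by simp
  have "of_nat n * (\<integral>\<^sup>+x. exp_gain n x \<partial>gauss_seq) = (\<integral>\<^sup>+x. of_nat n * exp_gain n x \<partial>gauss_seq)"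
    by (rule nn_integral_cmult[symmetric]) simp
  also have "\<dots> \<le> (\<integral>\<^sup>+x. (\<Sum>k\<in>{1..n}. \<Sum>i\<le>n-k. of_nat k * split_weight n k i (x \<circ> block_first k i)) \<partial>gauss_seq)"
    by (intro nn_integral_mono exp_gain_le_block_sum)
  also have "\<dots> = (\<Sum>k\<in>{1..n}. of_nat k * (\<Sum>i\<le>n-k. \<integral>\<^sup>+x. split_weight n k i (x \<circ> block_first k i) \<partial>gauss_seq))"
    by (simp add: nn_integral_sum nn_integral_cmult sum_distrib_left)
  also have "\<dots> \<le> (\<Sum>k\<in>{1..n}. 2 * (\<integral>\<^sup>+x. exp_gain (n - k) x \<partial>gauss_seq))"
  proof (rule sum_mono)
    fix k assume k: "k \<in> {1..n}"
    have "of_nat k * (\<Sum>i\<le>n-k. \<integral>\<^sup>+x. split_weight n k i (x \<circ> block_first k i) \<partial>gauss_seq)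
        \<le> (of_nat k * (\<integral>\<^sup>+y. block_weight k y \<partial>gauss_seq)) * (\<integral>\<^sup>+h. exp_gain (n - k) h \<partial>gauss_seq)"
      unfolding mult.assoc by (intro mult_left_mono sum_nn_integral_split_weight) simp
    also have "\<dots> \<le> 2 * (\<integral>\<^sup>+h. exp_gain (n - k) h \<partial>gauss_seq)"
      using k unfolding block_weight_def by (intro mult_right_mono nn_integral_unbroken) auto
    finally show "of_nat k * (\<Sum>i\<le>n-k. \<integral>\<^sup>+x. split_weight n k i (x \<circ> block_first k i) \<partial>gauss_seq)
        \<le> 2 * (\<integral>\<^sup>+x. exp_gain (n - k) x \<partial>gauss_seq)" .
  qed
  finally show ?thesis .
qed

lemma nn_integral_exp_gain: "(\<integral>\<^sup>+x. exp_gain n x \<partial>gauss_seq) \<le> of_nat (n + 1)"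
proof (induction n rule: less_induct)
  case (less n)
  show ?case
  proof (cases "n = 0")
    case True
    have "mono_gain 0 x = 0" for x
      by (rule mono_gain_attained[of 0 x]) (simp add: quad_gain_def)
    then have "exp_gain 0 x = 1" for x by (simp add: exp_gain_def)
    then show ?thesis using True by (simp add: std_normal.P.emeasure_space_1[simplified])
  next
    case False
    have "of_nat n * (\<integral>\<^sup>+x. exp_gain n x \<partial>gauss_seq) \<le> (\<Sum>k\<in>{1..n}. 2 * of_nat (n - k + 1))"
      by (rule order_trans[OF nn_integral_exp_gain_recursion], intro sum_mono mult_left_mono less)
        (use False in auto)
    also have "\<dots> = (of_nat (\<Sum>k\<in>{1..n}. 2 * (n - k + 1)) :: ennreal)"
      unfolding of_nat_sum of_nat_mult of_nat_numeral ..
    also have "(\<Sum>k\<in>{1..n}. 2 * (n - k + 1)) = n * (n + 1)"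
    proof -
      have "(\<Sum>k\<in>{1..n}. 2 * (n - k + 1)) = (\<Sum>k\<in>{1..n}. 2 * k)"
        by (rule sum.reindex_bij_witness[of _ "\<lambda>k. n + 1 - k" "\<lambda>k. n + 1 - k"]) auto
      also have "\<dots> = n * (n + 1)" by (induction n) auto
      finally show ?thesis .
    qed
    finally have le: "of_nat n * (\<integral>\<^sup>+x. exp_gain n x \<partial>gauss_seq) \<le> of_nat n * of_nat (n + 1)" by (simp only: of_nat_mult)
    have "(of_nat n :: ennreal) \<noteq> 0" "(of_nat n :: ennreal) \<noteq> top" using False by auto
    \<comment> \<open>Cancelling the factor \<open>n\<close> in \<open>ennreal\<close> requires it
      to be neither 0 nor infinite.\<close>
    then show ?thesis using le by (rule iffD1[OF ennreal_mult_le_mult_iff])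
  qed
qed

section \<open>Convex sequences\<close>

text \<open>Slopes increase, so once a step is nonnegative all later steps are; \<open>j\<close> is
  the start of the first such step.\<close>

lemma slopes_mono_valley:
  fixes u t :: "nat \<Rightarrow> real"
  assumes t: "\<And>i. Suc i < n \<Longrightarrow> t i < t (Suc i)"
    and slope: "\<And>i. Suc (Suc i) < n \<Longrightarrow>
      (u (Suc i) - u i) / (t (Suc i) - t i) \<le> (u (Suc (Suc i)) - u (Suc i)) / (t (Suc (Suc i)) - t (Suc i))"
  obtains j where "j \<le> n" "\<And>a b. a \<le> b \<Longrightarrow> b < j \<Longrightarrow> u b \<le> u a"
    "\<And>a b. j \<le> a \<Longrightarrow> a \<le> b \<Longrightarrow> b < n \<Longrightarrow> u a \<le> u b"
proof -
  \<comment> \<open>The alternative \<open>j = n\<close> covers sequences that decrease throughout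
    and guarantees that the least element exists.\<close>
  define j where "j = (LEAST j. j = n \<or> (Suc j < n \<and> u j \<le> u (Suc j)))"
  have j: "j = n \<or> (Suc j < n \<and> u j \<le> u (Suc j))"
    unfolding j_def by (rule LeastI[of _ n]) simp
  have low: "\<not> (l = n \<or> (Suc l < n \<and> u l \<le> u (Suc l)))" if "l < j" for l
    using not_less_Least that unfolding j_def by blast
  have "j \<le> n" using j by auto
  have dec: "u b \<le> u a" if "a \<le> b" "b < j" for a b
    using that
  proof (induction b rule: dec_induct)
    case (step b)
    then have "u (Suc b) \<le> u b" using low[of b] \<open>j \<le> n\<close> by auto
    then show ?case using step by simp
  qed simp
  have up: "Suc l < n \<Longrightarrow> u l \<le> u (Suc l)" if "j \<le> l" for l
    using that
  proof (induction l rule: dec_induct)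
    case base
    then show ?case using j by auto
  next
    case (step l)
    then have "0 \<le> (u (Suc l) - u l) / (t (Suc l) - t l)" using t[of l] by simp
    also have "\<dots> \<le> (u (Suc (Suc l)) - u (Suc l)) / (t (Suc (Suc l)) - t (Suc l))"
      using slope step by simp
    finally show ?case using t[OF step(4)] by (simp add: zero_le_divide_iff)
  qed
  have "u a \<le> u b" if "a \<le> b" "j \<le> a" "b < n" for a b
    using that
  proof (induction b rule: dec_induct)
    case (step b)
    then have "u b \<le> u (Suc b)" using up[of b] by auto
    then show ?case using step by simp
  qed simp
  then show thesis using that \<open>j \<le> n\<close> dec by blast
qed

definition reverse_prefix :: "nat \<Rightarrow> nat \<Rightarrow> nat" where
  "reverse_prefix j l = (if l < j then j - 1 - l else l)"

lemma inj_reverse_prefix: "inj (reverse_prefix j)"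
  by (rule injI) (auto simp: reverse_prefix_def split: if_splits)

text \<open>\<open>quad_gain\<close> is a sum over coordinates and so splits at \<open>j\<close>;
  reversing the decreasing part makes it a competitor in an isotonic problem.\<close>

lemma quad_gain_valley_le:
  assumes "j \<le> n" and dec: "\<And>a b. a \<le> b \<Longrightarrow> b < j \<Longrightarrow> u b \<le> u a"
    and inc: "\<And>a b. j \<le> a \<Longrightarrow> a \<le> b \<Longrightarrow> b < n \<Longrightarrow> u a \<le> u b"
  shows "quad_gain n w u \<le> mono_gain j (w \<circ> reverse_prefix j) + mono_gain (n - j) (\<lambda>l. w (j + l))"
proof -
  have "quad_gain n w u = quad_gain j w u + (\<Sum>l\<in>{j..<n}. 2 * w l * u l - (u l)\<^sup>2)"
    using assms(1) unfolding quad_gain_def by (simp add: lessThan_atLeast0 sum.atLeastLessThan_concat)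
  also have "(\<Sum>l\<in>{j..<n}. 2 * w l * u l - (u l)\<^sup>2) = quad_gain (n - j) (\<lambda>l. w (j + l)) (\<lambda>l. u (j + l))"
    using sum.shift_bounds_nat_ivl[of "\<lambda>l. 2 * w l * u l - (u l)\<^sup>2" 0 j "n - j"] assms(1)
    by (simp add: quad_gain_def lessThan_atLeast0 add.commute)
  also have "\<dots> \<le> mono_gain (n - j) (\<lambda>l. w (j + l))"
    by (intro quad_gain_le_mono_gain mono_onI inc) auto
  also have "quad_gain j w u = quad_gain j (w \<circ> reverse_prefix j) (u \<circ> reverse_prefix j)"
    unfolding quad_gain_def
    by (rule sum.reindex_bij_witness[of _ "\<lambda>l. j - 1 - l" "\<lambda>l. j - 1 - l"]) (auto simp: reverse_prefix_def)
  also have "\<dots> \<le> mono_gain j (w \<circ> reverse_prefix j)"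
    by (intro quad_gain_le_mono_gain mono_onI) (auto simp: reverse_prefix_def intro!: dec)
  finally show ?thesis by simp
qed

text \<open>The turning point depends on the data; summing over all candidates instead of maximising
  leaves products of independent factors.\<close>

definition valley_weight :: "nat \<Rightarrow> (nat \<Rightarrow> real) \<Rightarrow> ennreal" where
  "valley_weight n w = (\<Sum>j\<le>n. exp_gain j (w \<circ> reverse_prefix j) * exp_gain (n - j) (\<lambda>l. w (j + l)))"

lemma borel_measurable_valley_weight [measurable]: "valley_weight n \<in> borel_measurable borel"
proof -
  have [measurable]: "(\<lambda>w. exp_gain j (w \<circ> reverse_prefix j)) \<in> borel_measurable borel" for j
    using measurable_compose[OF measurable_seq_comp borel_measurable_exp_gain] .
  show ?thesis unfolding valley_weight_def by measurable
qed

lemma valley_weight_cong: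
  assumes "\<And>i. i < n \<Longrightarrow> w i = w' i"
  shows "valley_weight n w = valley_weight n w'"
  unfolding valley_weight_def exp_gain_def
proof (intro sum.cong refl arg_cong2[where f = "(*)"] arg_cong[where f = ennreal] arg_cong[where f = exp] mono_gain_cong)
  fix j i assume "j \<in> {..n}" "i < j"
  then show "(w \<circ> reverse_prefix j) i = (w' \<circ> reverse_prefix j) i"
    by (auto simp: reverse_prefix_def intro!: assms)
next
  fix j i assume "j \<in> {..n}" "i < n - j"
  then show "w (j + i) = w' (j + i)" by (auto intro!: assms)
qed

text \<open>For each \<open>j\<close> the two factors read disjoint coordinates, and reversal
  preserves the law, so the term is at most \<open>(j + 1) * (n - j + 1)\<close>, bounded crudely by
  \<open>(n + 1)^2\<close>; there are \<open>n + 1\<close> terms.\<close>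

lemma nn_integral_valley_weight:
  "(\<integral>\<^sup>+w. valley_weight n w \<partial>gauss_seq) \<le> of_nat ((n + 1) ^ 3)"
proof -
  have [measurable]: "(\<lambda>w. exp_gain j (w \<circ> reverse_prefix j)) \<in> borel_measurable borel" for j
    using measurable_compose[OF measurable_seq_comp borel_measurable_exp_gain] .
  have "(\<integral>\<^sup>+w. valley_weight n w \<partial>gauss_seq)
      = (\<Sum>j\<le>n. \<integral>\<^sup>+w. exp_gain j (w \<circ> reverse_prefix j) * exp_gain (n - j) (\<lambda>l. w (j + l)) \<partial>gauss_seq)"
    unfolding valley_weight_def by (rule nn_integral_sum) measurable
  also have "\<dots> \<le> (\<Sum>j\<le>n. of_nat ((n + 1) * (n + 1)))"
  proof (rule sum_mono)
    fix j assume "j \<in> {..n}"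
    have eq: "exp_gain j (comb_seq j y h \<circ> reverse_prefix j) = exp_gain j (y \<circ> reverse_prefix j)" for y h
      unfolding exp_gain_def
      by (intro arg_cong[where f = ennreal] arg_cong[where f = exp] arg_cong2[where f = "(*)"] refl mono_gain_cong)
        (auto simp: reverse_prefix_def comb_seq_def)
    have "(\<integral>\<^sup>+w. exp_gain j (w \<circ> reverse_prefix j) * exp_gain (n - j) (\<lambda>l. w (j + l)) \<partial>gauss_seq)
        = (\<integral>\<^sup>+y. \<integral>\<^sup>+h. exp_gain j (y \<circ> reverse_prefix j) * exp_gain (n - j) h \<partial>gauss_seq \<partial>gauss_seq)"
      by (subst nn_integral_gauss_seq_split[of _ j]) (measurable, simp add: eq, simp add: comb_seq_def)
    also have "\<dots> = (\<integral>\<^sup>+y. exp_gain j (y \<circ> reverse_prefix j) \<partial>gauss_seq) * (\<integral>\<^sup>+h. exp_gain (n - j) h \<partial>gauss_seq)"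
      by (simp add: nn_integral_cmult nn_integral_multc)
    also have "\<dots> = (\<integral>\<^sup>+y. exp_gain j y \<partial>gauss_seq) * (\<integral>\<^sup>+h. exp_gain (n - j) h \<partial>gauss_seq)"
      by (simp add: nn_integral_gauss_seq_reindex[OF inj_reverse_prefix])
    also have "\<dots> \<le> of_nat (j + 1) * of_nat (n - j + 1)"
      by (intro mult_mono nn_integral_exp_gain) auto
    also have "\<dots> \<le> of_nat ((n + 1) * (n + 1))"
      using \<open>j \<in> {..n}\<close> unfolding of_nat_mult[symmetric] by (intro of_nat_mono mult_mono) auto
    finally show "(\<integral>\<^sup>+w. exp_gain j (w \<circ> reverse_prefix j) * exp_gain (n - j) (\<lambda>l. w (j + l)) \<partial>gauss_seq)
        \<le> of_nat ((n + 1) * (n + 1))" .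
  qed
  also have "\<dots> = of_nat (\<Sum>j\<le>n. (n + 1) * (n + 1))" by (simp only: of_nat_sum)
  also have "(\<Sum>j\<le>n. (n + 1) * (n + 1)) = (n + 1) ^ 3" by (simp add: power3_eq_cube)
  finally show ?thesis .
qed

text \<open>Sequences count from 0 and \<open>idx\<close> from 1, hence the \<open>Suc\<close>. Only
  positions below the dimension are meaningful.\<close>

definition vec_seq :: "real ^ 'n::{finite, linorder} \<Rightarrow> nat \<Rightarrow> real" where
  "vec_seq z i = z $ idx (Suc i)"

lemma bij_betw_idx: "bij_betw (\<lambda>i. idx (Suc i)) {..<CARD('n)} (UNIV :: 'n::{finite, linorder} set)"
  using bij_betw_nth[of "sorted_list_of_set (UNIV :: 'n set)" "{..<CARD('n)}" UNIV]
  by (simp add: idx_def)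

lemma idx_less:
  assumes "i < j" "j < CARD('n)"
  shows "(idx (Suc i) :: 'n::{finite, linorder}) < idx (Suc j)"
  using strict_sorted_list_of_set[of "UNIV :: 'n set"] assms
  by (simp add: idx_def sorted_wrt_iff_nth_less)

lemma inner_vec_seq: "y \<bullet> z = (\<Sum>i<CARD('n). vec_seq y i * vec_seq z i)"
  for y z :: "real ^ 'n::{finite, linorder}"
  unfolding inner_vec_def vec_seq_def inner_real_def
  by (rule sum.reindex_bij_betw[OF bij_betw_idx, symmetric])

section \<open>Projection onto the cone of convex sequences\<close>

lemma convex_seq_cone_eq_Inter:
  "convex_seq_cone x = (\<Inter>i\<in>{2..CARD('n) - 1}. {u :: real ^ 'n::{finite, linorder}.
      (u $ idx i - u $ idx (i - 1)) / (x $ idx i - x $ idx (i - 1))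
        \<le> (u $ idx (i + 1) - u $ idx i) / (x $ idx (i + 1) - x $ idx i)})"
  unfolding convex_seq_cone_def by auto

lemma closed_convex_seq_cone: "closed (convex_seq_cone x)"
  unfolding convex_seq_cone_eq_Inter
  by (intro closed_INT ballI closed_Collect_le) (auto simp: divide_inverse intro!: continuous_intros)

lemma zero_in_convex_seq_cone: "0 \<in> convex_seq_cone x"
  by (simp add: convex_seq_cone_def)

lemma scaleR_in_convex_seq_cone:
  fixes x :: "real ^ 'n::{finite, linorder}"
  assumes "u \<in> convex_seq_cone x" "c \<ge> 0"
  shows "c *\<^sub>R u \<in> convex_seq_cone x"
  unfolding convex_seq_cone_def mem_Collect_eq
proof (intro ballI)
  fix i assume "i \<in> {2..CARD('n) - 1}"
  then have "c * ((u $ idx i - u $ idx (i - 1)) / (x $ idx i - x $ idx (i - 1)))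
      \<le> c * ((u $ idx (i + 1) - u $ idx i) / (x $ idx (i + 1) - x $ idx i))"
    using assms by (intro mult_left_mono) (auto simp: convex_seq_cone_def)
  then show "((c *\<^sub>R u) $ idx i - (c *\<^sub>R u) $ idx (i - 1)) / (x $ idx i - x $ idx (i - 1))
      \<le> ((c *\<^sub>R u) $ idx (i + 1) - (c *\<^sub>R u) $ idx i) / (x $ idx (i + 1) - x $ idx i)"
    by (simp add: right_diff_distrib[symmetric])
qed

lemma add_in_convex_seq_cone:
  fixes x :: "real ^ 'n::{finite, linorder}"
  assumes "u \<in> convex_seq_cone x" "v \<in> convex_seq_cone x"
  shows "u + v \<in> convex_seq_cone x"
  unfolding convex_seq_cone_def mem_Collect_eq
proof (intro ballI)
  fix i assume i: "i \<in> {2..CARD('n) - 1}"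
  define d where "d w = (w $ idx i - w $ idx (i - 1)) / (x $ idx i - x $ idx (i - 1))" for w :: "real ^ 'n::{finite, linorder}"
  define e where "e w = (w $ idx (i + 1) - w $ idx i) / (x $ idx (i + 1) - x $ idx i)" for w :: "real ^ 'n::{finite, linorder}"
  have "d (u + v) = d u + d v" "e (u + v) = e u + e v"
    by (simp_all add: d_def e_def diff_divide_distrib add_divide_distrib)
  moreover have "d u \<le> e u" "d v \<le> e v"
    using assms i by (auto simp: convex_seq_cone_def d_def e_def)
  ultimately have "d (u + v) \<le> e (u + v)" by simp
  then show "((u + v) $ idx i - (u + v) $ idx (i - 1)) / (x $ idx i - x $ idx (i - 1))
      \<le> ((u + v) $ idx (i + 1) - (u + v) $ idx i) / (x $ idx (i + 1) - x $ idx i)"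
    by (simp add: d_def e_def)
qed

lemma convex_convex_seq_cone: "convex (convex_seq_cone x)"
  by (intro convexI add_in_convex_seq_cone scaleR_in_convex_seq_cone)

text \<open>Testing the variational inequality of the projection \<open>p\<close> at 0 and at
  \<open>2 p\<close> shows that \<open>z - p\<close> is orthogonal to \<open>p\<close>. The
  right-hand side is written in the shape of \<open>quad_gain\<close>.\<close>

lemma norm_closest_point_cone:
  fixes L :: "'a::euclidean_space set"
  assumes "closed L" "convex L" "0 \<in> L" and scale: "\<And>u. u \<in> L \<Longrightarrow> 2 *\<^sub>R u \<in> L"
  shows "(norm (closest_point L z))\<^sup>2 = 2 * (z \<bullet> closest_point L z) - (norm (closest_point L z))\<^sup>2"
proof -
  define p where "p = closest_point L z"
  have "p \<in> L" unfolding p_def using assms by (intro closest_point_in_set) auto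
  have "(z - p) \<bullet> (0 - p) \<le> 0" "(z - p) \<bullet> (2 *\<^sub>R p - p) \<le> 0"
    unfolding p_def by (intro closest_point_dot assms \<open>p \<in> L\<close>[unfolded p_def])+
  then have "z \<bullet> p = p \<bullet> p" by (simp add: inner_diff_left inner_diff_right scaleR_2 inner_add_right)
  then show ?thesis by (simp add: p_def power2_norm_eq_inner)
qed

text \<open>The projection is itself a convex sequence, so it has a valley at some \<open>j\<close>,
  and the summand of \<open>valley_weight\<close> for that \<open>j\<close> already
  dominates.\<close>

lemma exp_closest_point_le_valley_weight:
  fixes x :: "real ^ 'n::{finite, linorder}"
  assumes "strict_mono (($) x)"
  shows "ennreal (exp (3/8 * (norm (closest_point (convex_seq_cone x) z))\<^sup>2))
    \<le> valley_weight CARD('n) (vec_seq z)"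
proof -
  define n where "n = CARD('n)"
  define p where "p = closest_point (convex_seq_cone x) z"
  have p: "p \<in> convex_seq_cone x"
    unfolding p_def using closed_convex_seq_cone zero_in_convex_seq_cone
    by (intro closest_point_in_set) auto
  have "(norm p)\<^sup>2 = 2 * (z \<bullet> p) - (norm p)\<^sup>2"
    unfolding p_def
    by (intro norm_closest_point_cone closed_convex_seq_cone convex_convex_seq_cone
        zero_in_convex_seq_cone scaleR_in_convex_seq_cone) auto
  also have "\<dots> = quad_gain n (vec_seq z) (vec_seq p)"
    unfolding quad_gain_def n_def power2_norm_eq_inner inner_vec_seq
    by (simp add: sum_subtractf sum_distrib_left power2_eq_square mult.assoc)
  finally have np: "(norm p)\<^sup>2 = quad_gain n (vec_seq z) (vec_seq p)" .
  have t: "vec_seq x i < vec_seq x (Suc i)" if "Suc i < n" for i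
    using that assms idx_less[of i "Suc i", where 'n = 'n] unfolding vec_seq_def n_def
    by (auto simp: strict_mono_def)
  have slope: "(vec_seq p (Suc i) - vec_seq p i) / (vec_seq x (Suc i) - vec_seq x i)
      \<le> (vec_seq p (Suc (Suc i)) - vec_seq p (Suc i)) / (vec_seq x (Suc (Suc i)) - vec_seq x (Suc i))"
    if "Suc (Suc i) < n" for i
  proof -
    have "Suc (Suc i) \<in> {2..CARD('n) - 1}" using that by (auto simp: n_def)
    then show ?thesis using p unfolding convex_seq_cone_def vec_seq_def by fastforce
  qed
  obtain j where j: "j \<le> n" "\<And>a b. a \<le> b \<Longrightarrow> b < j \<Longrightarrow> vec_seq p b \<le> vec_seq p a"
    "\<And>a b. j \<le> a \<Longrightarrow> a \<le> b \<Longrightarrow> b < n \<Longrightarrow> vec_seq p a \<le> vec_seq p b"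
    using slopes_mono_valley[of n "vec_seq x" "vec_seq p"] t slope by metis
  have "(norm p)\<^sup>2 \<le> mono_gain j (vec_seq z \<circ> reverse_prefix j) + mono_gain (n - j) (\<lambda>l. vec_seq z (j + l))"
    unfolding np by (rule quad_gain_valley_le[OF j])
  then have "ennreal (exp (3/8 * (norm p)\<^sup>2))
      \<le> ennreal (exp (3/8 * mono_gain j (vec_seq z \<circ> reverse_prefix j) + 3/8 * mono_gain (n - j) (\<lambda>l. vec_seq z (j + l))))"
    by (intro ennreal_leI) simp
  also have "\<dots> = exp_gain j (vec_seq z \<circ> reverse_prefix j) * exp_gain (n - j) (\<lambda>l. vec_seq z (j + l))"
    by (simp add: exp_gain_def exp_add ennreal_mult)
  also have "\<dots> \<le> valley_weight n (vec_seq z)"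
    unfolding valley_weight_def using j(1)
    by (intro member_le_sum[of j "{..n}" "\<lambda>j. exp_gain j (vec_seq z \<circ> reverse_prefix j) * exp_gain (n - j) (\<lambda>l. vec_seq z (j + l))"]) auto
  finally show ?thesis unfolding p_def n_def .
qed

section \<open>Transfer to Euclidean space\<close>

lemma Basis_real_vec: "(Basis :: (real ^ 'n) set) = range (\<lambda>c. axis c 1)"
  by (auto simp: Basis_vec_def)

lemma nn_integral_lborel_vec_prod:
  fixes f :: "'n::finite \<Rightarrow> real \<Rightarrow> ennreal"
  assumes [measurable]: "\<And>c. f c \<in> borel_measurable borel"
  shows "(\<integral>\<^sup>+z. (\<Prod>c\<in>UNIV. f c (z $ c)) \<partial>(lborel :: (real ^ 'n) measure)) = (\<Prod>c\<in>UNIV. \<integral>\<^sup>+y. f c y \<partial>lborel)"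
proof -
  define ax :: "'n \<Rightarrow> real ^ 'n" where "ax c = axis c 1" for c
  have inj: "inj ax" by (auto simp: ax_def inj_def axis_eq_axis)
  have B: "Basis = range ax" using Basis_real_vec by (simp add: ax_def)
  have "(\<integral>\<^sup>+z. (\<Prod>c\<in>UNIV. f c (z $ c)) \<partial>(lborel :: (real ^ 'n) measure))
      = (\<integral>\<^sup>+z. (\<Prod>b\<in>Basis. f (inv ax b) (z \<bullet> b)) \<partial>lborel)"
    unfolding B prod.reindex[OF inj] by (simp add: inv_f_f[OF inj]) (simp add: ax_def inner_axis)
  also have "\<dots> = (\<Prod>b\<in>Basis. \<integral>\<^sup>+y. f (inv ax b) y \<partial>lborel)"
    by (rule nn_integral_lborel_prod) auto
  also have "\<dots> = (\<Prod>c\<in>UNIV. \<integral>\<^sup>+y. f c y \<partial>lborel)"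
    unfolding B prod.reindex[OF inj] by (simp add: inv_f_f[OF inj])
  finally show ?thesis .
qed

lemma borel_measurable_vec_nth_real [measurable]: "(\<lambda>z::real ^ 'n. z $ c) \<in> borel_measurable borel"
  by (intro borel_measurable_continuous_onI continuous_intros)

lemma borel_measurable_std_gaussian_density [measurable]:
  "(std_gaussian_density :: real ^ 'n \<Rightarrow> real) \<in> borel_measurable borel"
  unfolding std_gaussian_density_def by measurable

lemma sets_std_gaussian [measurable_cong]: "sets std_gaussian = sets borel"
  by (simp add: std_gaussian_def)

lemma borel_measurable_vec_seq [measurable]: "(\<lambda>z. vec_seq z i) \<in> borel_measurable borel"
  unfolding vec_seq_def by measurable

text \<open>A finite product measure is determined by its values on boxes; the preimage of a box is
  a box of vectors, over which the Gaussian density factorises.\<close>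

lemma distr_std_gaussian_vec_seq:
  "distr (std_gaussian :: (real ^ 'n::{finite, linorder}) measure) (PiM {..<CARD('n)} (\<lambda>_. std_normal))
      (\<lambda>z. restrict (vec_seq z) {..<CARD('n)}) = PiM {..<CARD('n)} (\<lambda>_. std_normal)"
proof (rule std_normal.PiM_eqI)
  let ?n = "CARD('n)" and ?ix = "\<lambda>i. idx (Suc i) :: 'n"
    and ?v = "\<lambda>z :: real ^ 'n::{finite, linorder}. restrict (vec_seq z) {..<CARD('n)}"
  fix A :: "nat \<Rightarrow> real set"
  assume A: "\<And>i. i \<in> {..<?n} \<Longrightarrow> A i \<in> sets std_normal"
  \<comment> \<open>\<open>rk c\<close> is the zero-based rank of the index \<open>c\<close>, the
    inverse of the enumeration by \<open>idx\<close>.\<close>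
  define rk where "rk = inv_into {..<?n} ?ix"
  have bij: "bij_betw ?ix {..<?n} UNIV" by (rule bij_betw_idx)
  have rk: "rk (?ix i) = i" if "i < ?n" for i
    unfolding rk_def using bij that by (auto simp: bij_betw_def intro!: inv_into_f_f)
  have rk_less: "rk c < ?n" "?ix (rk c) = c" for c
    unfolding rk_def using bij inv_into_into[of c ?ix "{..<?n}"] f_inv_into_f[of c ?ix "{..<?n}"]
    by (auto simp: bij_betw_def)
  have Ab [measurable]: "A (rk c) \<in> sets borel" for c using A[of "rk c"] rk_less by simp
  define X where "X = {z :: real ^ 'n::{finite, linorder}. \<forall>c. z $ c \<in> A (rk c)}"
  have [measurable]: "X \<in> sets borel" unfolding X_def by measurable
  have pre: "?v -` PiE {..<?n} A \<inter> space std_gaussian = X"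
  proof -
    have "(\<forall>i<?n. z $ ?ix i \<in> A i) \<longleftrightarrow> (\<forall>c. z $ c \<in> A (rk c))" for z :: "real ^ 'n::{finite, linorder}"
    proof safe
      fix c assume "\<forall>i<?n. z $ ?ix i \<in> A i"
      then have "z $ ?ix (rk c) \<in> A (rk c)" using rk_less(1) by blast
      then show "z $ c \<in> A (rk c)" by (simp only: rk_less(2))
    next
      fix i assume "\<forall>c. z $ c \<in> A (rk c)" "i < ?n"
      then have "z $ ?ix i \<in> A (rk (?ix i))" by blast
      then show "z $ ?ix i \<in> A i" by (simp only: rk[OF \<open>i < ?n\<close>])
    qed
    then show ?thesis
      by (simp add: X_def std_gaussian_def vec_seq_def PiE_iff vimage_def Ball_def)
  qed
  have mr: "?v \<in> std_gaussian \<rightarrow>\<^sub>M PiM {..<?n} (\<lambda>_. std_normal)"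
    by (rule measurable_restrict) simp
  have "emeasure (distr std_gaussian (PiM {..<?n} (\<lambda>_. std_normal)) ?v) (PiE {..<?n} A)
      = emeasure std_gaussian X"
    unfolding pre[symmetric] using A by (intro emeasure_distr mr sets_PiM_I_finite) auto
  also have "\<dots> = (\<integral>\<^sup>+z. ennreal (std_gaussian_density z) * indicator X z \<partial>lborel)"
    unfolding std_gaussian_def by (rule emeasure_density) auto
  also have "\<dots> = (\<integral>\<^sup>+z. (\<Prod>c\<in>UNIV. ennreal (std_normal_density (z $ c)) * indicator (A (rk c)) (z $ c)) \<partial>lborel)"
  proof (rule nn_integral_cong)
    fix z :: "real ^ 'n::{finite, linorder}"
    have "indicator X z = (\<Prod>c\<in>UNIV. indicator (A (rk c)) (z $ c) :: ennreal)"
      by (auto simp: X_def indicator_def prod_eq_1_iff intro!: prod_zero)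
    then show "ennreal (std_gaussian_density z) * indicator X z
        = (\<Prod>c\<in>UNIV. ennreal (std_normal_density (z $ c)) * indicator (A (rk c)) (z $ c))"
      by (simp add: std_gaussian_density_def prod_ennreal prod.distrib)
  qed
  also have "\<dots> = (\<Prod>c\<in>UNIV. \<integral>\<^sup>+y. ennreal (std_normal_density y) * indicator (A (rk c)) y \<partial>lborel)"
    by (rule nn_integral_lborel_vec_prod) measurable
  also have "\<dots> = (\<Prod>c\<in>UNIV. emeasure std_normal (A (rk c)))"
    by (simp add: emeasure_density)
  also have "\<dots> = (\<Prod>i<?n. emeasure std_normal (A (rk (?ix i))))"
    by (rule prod.reindex_bij_betw[OF bij, symmetric])
  also have "\<dots> = (\<Prod>i<?n. emeasure std_normal (A i))"
    by (intro prod.cong) (auto simp: rk)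
  finally show "emeasure (distr std_gaussian (PiM {..<?n} (\<lambda>_. std_normal)) ?v) (PiE {..<?n} A)
      = (\<Prod>i<?n. emeasure std_normal (A i))" .
qed auto

text \<open>Both sides are integrals over the same finite product measure, because \<open>F\<close>
  reads only the coordinates below the dimension.\<close>

lemma nn_integral_std_gaussian_vec_seq:
  fixes F :: "(nat \<Rightarrow> real) \<Rightarrow> ennreal"
  assumes [measurable]: "F \<in> borel_measurable borel"
    and cong: "\<And>w w'. (\<And>i. i < CARD('n) \<Longrightarrow> w i = w' i) \<Longrightarrow> F w = F w'"
  shows "(\<integral>\<^sup>+z. F (vec_seq z) \<partial>(std_gaussian :: (real ^ 'n::{finite, linorder}) measure)) = (\<integral>\<^sup>+w. F w \<partial>gauss_seq)"
proof -
  let ?n = "CARD('n)" and ?P = "PiM {..<CARD('n)} (\<lambda>_. std_normal)"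
  \<comment> \<open>Finite sequences are extended by 0 so that \<open>F\<close> can be evaluated on
    them; by \<open>cong\<close> the padding does not affect the value.\<close>
  define e where "e v i = (if i < ?n then v i else 0)" for v :: "nat \<Rightarrow> real" and i
  have [measurable]: "(\<lambda>v. F (e v)) \<in> borel_measurable ?P"
  proof (rule measurable_compose[OF borel_measurable_seqI assms(1)])
    fix i
    show "(\<lambda>v. e v i) \<in> borel_measurable ?P"
      using measurable_component_singleton[of i "{..<?n}" "\<lambda>_. std_normal"] by (cases "i < ?n") (auto simp: e_def)
  qed
  have Fe: "F w = F (e (restrict w {..<?n}))" for w
    by (rule cong) (simp add: e_def)
  have "(\<integral>\<^sup>+z. F (vec_seq z) \<partial>(std_gaussian :: (real ^ 'n::{finite, linorder}) measure))
      = (\<integral>\<^sup>+v. F (e v) \<partial>distr (std_gaussian :: (real ^ 'n::{finite, linorder}) measure) ?P (\<lambda>z. restrict (vec_seq z) {..<?n}))"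
    by (subst nn_integral_distr) (auto simp: Fe[symmetric] intro!: measurable_restrict)
  also have "\<dots> = (\<integral>\<^sup>+v. F (e v) \<partial>?P)" by (simp only: distr_std_gaussian_vec_seq)
  also have "?P = distr gauss_seq ?P (\<lambda>w. restrict w {..<?n})"
    using distr_PiM_reindex[of UNIV "\<lambda>_. std_normal" "\<lambda>i. i" "{..<?n}"] by (simp add: prob_space_normal_density)
  also have "(\<integral>\<^sup>+v. F (e v) \<partial>distr gauss_seq ?P (\<lambda>w. restrict w {..<?n})) = (\<integral>\<^sup>+w. F w \<partial>gauss_seq)"
    by (subst nn_integral_distr) (auto simp: Fe[symmetric] intro!: measurable_restrict)
  finally show ?thesis .
qed

text \<open>Jensen's inequality for the logarithm, proved through its tangent at \<open>C\<close>.
  The pointwise bound also dominates \<open>V\<close> by an integrable function, which gives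
  integrability.\<close>

lemma (in prob_space) expectation_le_ln_exp_moment:
  fixes V :: "'a \<Rightarrow> real"
  assumes [measurable]: "V \<in> borel_measurable M" and "\<And>\<omega>. V \<omega> \<ge> 0" and "t > 0" "C > 0"
    and moment: "(\<integral>\<^sup>+\<omega>. ennreal (exp (t * V \<omega>)) \<partial>M) \<le> ennreal C"
  shows "integrable M V" "expectation V \<le> ln C / t"
proof -
  have exp_int: "integrable M (\<lambda>\<omega>. exp (t * V \<omega>))"
    using moment by (intro integrableI_bounded) (auto simp: less_top[symmetric] top_unique)
  have "ennreal (expectation (\<lambda>\<omega>. exp (t * V \<omega>))) \<le> ennreal C"
    using moment by (subst nn_integral_eq_integral[OF exp_int, symmetric]) auto
  then have exp_le: "expectation (\<lambda>\<omega>. exp (t * V \<omega>)) \<le> C" using \<open>C > 0\<close> by simp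
  have bound: "V \<omega> \<le> (ln C + exp (t * V \<omega>) / C - 1) / t" for \<omega>
  proof -
    have "ln (exp (t * V \<omega>) / C) \<le> exp (t * V \<omega>) / C - 1" using \<open>C > 0\<close> by (intro ln_le_minus_one) auto
    moreover have "ln (exp (t * V \<omega>) / C) = t * V \<omega> - ln C" using \<open>C > 0\<close> by (simp add: ln_div)
    ultimately show ?thesis using \<open>t > 0\<close> by (simp add: field_simps)
  qed
  have bint: "integrable M (\<lambda>\<omega>. (ln C + exp (t * V \<omega>) / C - 1) / t)"
    using exp_int by (intro integrable_divide Bochner_Integration.integrable_add Bochner_Integration.integrable_diff) auto
  show V: "integrable M V"
    by (rule Bochner_Integration.integrable_bound[OF bint])
      (simp_all only: real_norm_def abs_of_nonneg[OF assms(2)] assms(1) AE_I2 order_trans[OF bound abs_ge_self])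
  have "expectation V \<le> expectation (\<lambda>\<omega>. (ln C + exp (t * V \<omega>) / C - 1) / t)"
    by (rule integral_mono[OF V bint bound])
  also have "\<dots> = (ln C + expectation (\<lambda>\<omega>. exp (t * V \<omega>)) / C - 1) / t"
    using exp_int by (simp add: prob_space)
  also have "\<dots> \<le> ln C / t" using exp_le \<open>C > 0\<close> \<open>t > 0\<close> by (simp add: divide_simps)
  finally show "expectation V \<le> ln C / t" .
qed

theorem theorem4p1:
  fixes x :: "real ^ 'n::{finite, linorder}"
    and M :: "'w measure"
    and g :: "'w \<Rightarrow> real ^ 'n::{finite, linorder}"
  assumes "CARD('n) \<ge> 3"
    and "strict_mono (($) x)"
    and "prob_space M"
    and "distributed M lborel g (\<lambda>z. ennreal (std_gaussian_density z))"
  shows "integrable M (\<lambda>\<omega>. (norm (closest_point (convex_seq_cone x) (g \<omega>)))\<^sup>2)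
    \<and> statistical_dimension (convex_seq_cone x)
        = prob_space.expectation M (\<lambda>\<omega>. (norm (closest_point (convex_seq_cone x) (g \<omega>)))\<^sup>2)
    \<and> prob_space.expectation M (\<lambda>\<omega>. (norm (closest_point (convex_seq_cone x) (g \<omega>)))\<^sup>2)
        \<le> 8 * ln (exp 1 * real CARD('n))"
proof -
  interpret prob_space M by fact
  define n where "n = CARD('n)"
  define V where "V z = (norm (closest_point (convex_seq_cone x) z))\<^sup>2" for z
  have V_nonneg: "V z \<ge> 0" for z by (simp add: V_def)
  \<comment> \<open>Projection onto a nonempty closed convex set is continuous, which settles
    measurability.\<close>
  have "continuous_on UNIV V"
    unfolding V_def using zero_in_convex_seq_cone
    by (intro continuous_intros continuous_on_closest_point convex_convex_seq_cone closed_convex_seq_cone) auto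
  then have [measurable]: "V \<in> borel_measurable borel" by (rule borel_measurable_continuous_onI)
  have [measurable]: "g \<in> M \<rightarrow>\<^sub>M borel"
    using assms(4) by (simp add: distributed_def)
  have distr: "distr M lborel g = std_gaussian"
    using distributed_distr_eq_density[OF assms(4)] by (simp add: std_gaussian_def)
  have "(\<integral>\<^sup>+\<omega>. ennreal (exp (3/8 * V (g \<omega>))) \<partial>M) = (\<integral>\<^sup>+z. ennreal (exp (3/8 * V z)) \<partial>std_gaussian)"
    unfolding distr[symmetric] by (subst nn_integral_distr) auto
  also have "\<dots> \<le> (\<integral>\<^sup>+z. valley_weight n (vec_seq z) \<partial>(std_gaussian :: (real ^ 'n::{finite, linorder}) measure))"
    unfolding V_def n_def by (intro nn_integral_mono exp_closest_point_le_valley_weight assms)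
  also have "\<dots> = (\<integral>\<^sup>+w. valley_weight n w \<partial>gauss_seq)"
    unfolding n_def by (rule nn_integral_std_gaussian_vec_seq) (auto intro: valley_weight_cong)
  also have "\<dots> \<le> of_nat ((n + 1) ^ 3)" by (rule nn_integral_valley_weight)
  also have "\<dots> = ennreal (real ((n + 1) ^ 3))" by (rule ennreal_of_nat_eq_real_of_nat)
  also have "\<dots> \<le> ennreal ((exp 1 * real n) ^ 3)"
  proof (rule ennreal_leI)
    have "real n + 1 \<le> 2 * real n" using assms(1) by (simp add: n_def)
    also have "\<dots> \<le> exp 1 * real n"
      \<comment> \<open>Here \<open>exp 1\<close> is at least 1 + 1 = 2.\<close>
      using exp_ge_add_one_self[of 1] by (intro mult_right_mono) auto
    finally have "(real n + 1) ^ 3 \<le> (exp 1 * real n) ^ 3" by (intro power_mono) auto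
    then show "real ((n + 1) ^ 3) \<le> (exp 1 * real n) ^ 3" by (simp add: add.commute)
  qed
  finally have moment: "(\<integral>\<^sup>+\<omega>. ennreal (exp (3/8 * V (g \<omega>))) \<partial>M) \<le> ennreal ((exp 1 * real n) ^ 3)" .
  have "n > 0" using assms(1) by (simp add: n_def)
  then have pos: "(exp 1 * real n) ^ 3 > 0" by simp
  have "integrable M (\<lambda>\<omega>. V (g \<omega>))" "expectation (\<lambda>\<omega>. V (g \<omega>)) \<le> ln ((exp 1 * real n) ^ 3) / (3/8)"
    using expectation_le_ln_exp_moment[OF _ _ _ pos moment] V_nonneg by simp_all
  \<comment> \<open>The constant of the theorem arises as 3 / (3/8) = 8: the cube of the moment
    bound over the weight in the exponent.\<close>
  moreover have "ln ((exp 1 * real n) ^ 3) / (3/8) = 8 * ln (exp 1 * real n)"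
    using \<open>n > 0\<close> by (simp add: ln_realpow)
  moreover have "statistical_dimension (convex_seq_cone x) = expectation (\<lambda>\<omega>. V (g \<omega>))"
    unfolding statistical_dimension_def V_def[symmetric] distr[symmetric]
    by (subst integral_distr) auto
  ultimately show ?thesis unfolding V_def n_def by metis
qed

end
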